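(* Let $p\in(1,2)$. There does not exist a constant $\mu\in(0,\infty)$ such that for every integer $h\ge1$ and every $\lambda\in[1,\infty)$ the inequality $c_{\ell_p}(T^\omega_h)\le\mu\lambda$ holds whenever $T^\omega_h$ is $\lambda$-finitely representable in $\ell_p$.
   Context: For metric spaces $X,Y$, a map $f\colon X\to Y$ is a bi-Lipschitz embedding if it is one-to-one and both $f$ and $f^{-1}$ (defined on $f(X)$) are Lipschitz; its distortion is $\mathrm{dist}(f)=\mathrm{Lip}(f)\cdot\mathrm{Lip}(f^{-1})$. $c_Y(X)$ denotes the infimum of $\mathrm{dist}(f)$ over all bi-Lipschitz embeddings $f\colon X\to Y$, and $c_Y(X)=\infty$ if there are none. For $\lambda\in[1,\infty)$, a metric space $X$ is $\lambda$-finitely representable in a metric space $Y$ if $c_Y(F)\le\lambda$ for every finite subset $F$ of $X$. For a positive integer $h$, $T^\omega_h$ is the unweighted complete countably branching rooted tree of height $h$ (its vertices are the finite sequences of positive integers of length at most $h$, the root being the empty sequence, and each sequence of length $<h$ is joined by an edge to each of its one-term extensions), equipped with the shortest path metric on its vertex set. *)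

theory Defs
  imports "HOL-Analysis.Analysis"
begin

text \<open>The best Lipschitz constant \<open>Lip f\<close> of a map between metric spaces. It is only
  meaningful for Lipschitz maps, for which the set of admissible constants is nonempty.\<close>

definition Lip :: "'a metric \<Rightarrow> 'b metric \<Rightarrow> ('a \<Rightarrow> 'b) \<Rightarrow> real" where
  "Lip X Y f = Inf {L. 0 \<le> L \<and>
     (\<forall>x\<in>mspace X. \<forall>y\<in>mspace X. mdist Y (f x) (f y) \<le> L * mdist X x y)}"

definition bi_Lipschitz_embedding :: "'a metric \<Rightarrow> 'b metric \<Rightarrow> ('a \<Rightarrow> 'b) \<Rightarrow> bool" where
  "bi_Lipschitz_embedding X Y f \<longleftrightarrow>
     inj_on f (mspace X) \<and>
     Lipschitz_continuous_map X Y f \<and>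
     Lipschitz_continuous_map (submetric Y (f ` mspace X)) X (inv_into (mspace X) f)"

definition distortion :: "'a metric \<Rightarrow> 'b metric \<Rightarrow> ('a \<Rightarrow> 'b) \<Rightarrow> real" where
  "distortion X Y f =
     Lip X Y f * Lip (submetric Y (f ` mspace X)) X (inv_into (mspace X) f)"

text \<open>\<open>c_dist Y X\<close> is the quantity usually written \<open>c\<^sub>Y(X)\<close>; the infimum of the empty set
  in \<^typ>\<open>ereal\<close> is \<open>\<infinity>\<close>.\<close>

definition c_dist :: "'b metric \<Rightarrow> 'a metric \<Rightarrow> ereal" where
  "c_dist Y X = (INF f\<in>{f. bi_Lipschitz_embedding X Y f}. ereal (distortion X Y f))"

definition finitely_representable :: "real \<Rightarrow> 'a metric \<Rightarrow> 'b metric \<Rightarrow> bool" where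
  "finitely_representable l X Y \<longleftrightarrow>
     (\<forall>F. finite F \<and> F \<subseteq> mspace X \<longrightarrow> c_dist Y (submetric X F) \<le> ereal l)"

definition lp_space :: "real \<Rightarrow> (nat \<Rightarrow> real) set" where
  "lp_space p = {x. summable (\<lambda>n. \<bar>x n\<bar> powr p)}"

definition lp_norm :: "real \<Rightarrow> (nat \<Rightarrow> real) \<Rightarrow> real" where
  "lp_norm p x = (\<Sum>n. \<bar>x n\<bar> powr p) powr (1 / p)"

definition lp_dist :: "real \<Rightarrow> (nat \<Rightarrow> real) \<Rightarrow> (nat \<Rightarrow> real) \<Rightarrow> real" where
  "lp_dist p x y = lp_norm p (\<lambda>n. x n - y n)"

definition lp_metric :: "real \<Rightarrow> (nat \<Rightarrow> real) metric" where
  "lp_metric p = metric (lp_space p, lp_dist p)"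

lemma convex_on_powr_nonneg:
  assumes "1 \<le> (p::real)"
  shows "convex_on {0..} (\<lambda>t. t powr p)"
proof (rule convex_onI)
  note c = powr_convex[OF assms]
  fix t x y :: real
  assume t: "0 < t" "t < 1" and xy: "x \<in> {0..}" "y \<in> {0..}"
  have small: "s powr p \<le> s" if "0 \<le> s" "s \<le> 1" for s :: real
    using powr_mono'[of 1 p s] that assms by simp
  consider "x = 0" | "y = 0" | "0 < x" "0 < y" using xy by fastforce
  then show "((1 - t) *\<^sub>R x + t *\<^sub>R y) powr p \<le> (1 - t) * x powr p + t * y powr p"
  proof cases
    case 1
    then show ?thesis using small[of t] t xy
      by (simp add: powr_mult mult_right_mono)
  next
    case 2
    then show ?thesis using small[of "1 - t"] t xy
      by (simp add: powr_mult mult_right_mono)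
  next
    case 3
    then show ?thesis using convex_onD[OF c, of t x y] t by simp
  qed
qed simp

lemma lp_add:
  assumes p: "1 \<le> p" and x: "x \<in> lp_space p" and y: "y \<in> lp_space p"
  shows "(\<lambda>n. x n + y n) \<in> lp_space p"
    and "lp_norm p (\<lambda>n. x n + y n) \<le> lp_norm p x + lp_norm p y"
proof -
  define X where "X = (\<Sum>n. \<bar>x n\<bar> powr p)"
  define Y where "Y = (\<Sum>n. \<bar>y n\<bar> powr p)"
  have sx: "summable (\<lambda>n. \<bar>x n\<bar> powr p)" and sy: "summable (\<lambda>n. \<bar>y n\<bar> powr p)"
    using x y by (auto simp: lp_space_def)
  have X0: "0 \<le> X" and Y0: "0 \<le> Y"
    unfolding X_def Y_def using sx sy by (auto intro: suminf_nonneg)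
  have main: "summable (\<lambda>n. \<bar>x n + y n\<bar> powr p) \<and> (\<Sum>n. \<bar>x n + y n\<bar> powr p) \<le> (a + b) powr p"
    if a: "0 < a" "X \<le> a powr p" and b: "0 < b" "Y \<le> b powr p" for a b
  proof -
    define t where "t = b / (a + b)"
    have t: "0 \<le> t" "t \<le> 1" and t1: "1 - t = a / (a + b)"
      using a b by (auto simp: t_def field_simps)
    define g where "g n = (a + b) powr p *
      ((1 - t) / a powr p * \<bar>x n\<bar> powr p + t / b powr p * \<bar>y n\<bar> powr p)" for n
    have le: "\<bar>x n + y n\<bar> powr p \<le> g n" for n
    proof -
      have e: "(\<bar>x n\<bar> + \<bar>y n\<bar>) / (a + b) = (1 - t) * (\<bar>x n\<bar> / a) + t * (\<bar>y n\<bar> / b)"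
        using a b by (simp add: t1) (simp add: t_def add_divide_distrib)
      have "\<bar>x n + y n\<bar> powr p \<le> (\<bar>x n\<bar> + \<bar>y n\<bar>) powr p"
        using p by (intro powr_mono2) auto
      also have "\<dots> = (a + b) powr p * ((\<bar>x n\<bar> + \<bar>y n\<bar>) / (a + b)) powr p"
        using a b by (simp add: powr_divide)
      also have "\<dots> \<le> (a + b) powr p * ((1 - t) * (\<bar>x n\<bar> / a) powr p + t * (\<bar>y n\<bar> / b) powr p)"
        unfolding e using convex_onD[OF convex_on_powr_nonneg[OF p], of t "\<bar>x n\<bar> / a" "\<bar>y n\<bar> / b"] t a b
        by (intro mult_left_mono) auto
      also have "\<dots> = g n"
        using a b by (simp add: g_def powr_divide)
      finally show ?thesis .
    qed
    have gs: "g sums ((a + b) powr p * ((1 - t) / a powr p * X + t / b powr p * Y))"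
      unfolding g_def X_def Y_def using sx sy
      by (intro sums_mult sums_add summable_sums)
    have s: "summable (\<lambda>n. \<bar>x n + y n\<bar> powr p)"
      by (rule summable_comparison_test'[OF sums_summable[OF gs], of 0]) (use le in auto)
    have "(\<Sum>n. \<bar>x n + y n\<bar> powr p) \<le> suminf g"
      by (rule suminf_le[OF le s sums_summable[OF gs]])
    also have "\<dots> = (a + b) powr p * ((1 - t) * (X / a powr p) + t * (Y / b powr p))"
      using sums_unique[OF gs] by simp
    also have "\<dots> \<le> (a + b) powr p * ((1 - t) * 1 + t * 1)"
      using a b t by (intro mult_left_mono add_mono) auto
    finally show ?thesis using s by simp
  qed
  have bound: "0 < Z powr (1 / p) + e \<and> Z \<le> (Z powr (1 / p) + e) powr p" if "0 < e" "0 \<le> Z" for Z e :: real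
  proof -
    have "Z = (Z powr (1 / p)) powr p" using that p by (simp add: powr_powr)
    also have "\<dots> \<le> (Z powr (1 / p) + e) powr p" using that p by (intro powr_mono2) auto
    finally show ?thesis using that powr_ge_zero[of Z "1 / p"] by linarith
  qed
  have eps: "summable (\<lambda>n. \<bar>x n + y n\<bar> powr p) \<and>
    (\<Sum>n. \<bar>x n + y n\<bar> powr p) \<le> (X powr (1 / p) + e + (Y powr (1 / p) + e)) powr p" if "0 < e" for e
    using main bound[OF that X0] bound[OF that Y0] by blast
  then have s: "summable (\<lambda>n. \<bar>x n + y n\<bar> powr p)" using zero_less_one by blast
  then show "(\<lambda>n. x n + y n) \<in> lp_space p" by (simp add: lp_space_def)
  show "lp_norm p (\<lambda>n. x n + y n) \<le> lp_norm p x + lp_norm p y"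
  proof (rule field_le_epsilon)
    fix e :: real assume e: "0 < e"
    have "lp_norm p (\<lambda>n. x n + y n) \<le>
      ((X powr (1 / p) + e / 2 + (Y powr (1 / p) + e / 2)) powr p) powr (1 / p)"
      unfolding lp_norm_def using eps[of "e / 2"] e p s
      by (intro powr_mono2) (auto intro: suminf_nonneg)
    also have "\<dots> = lp_norm p x + lp_norm p y + e"
      using p e by (simp add: powr_powr lp_norm_def X_def Y_def)
    finally show "lp_norm p (\<lambda>n. x n + y n) \<le> lp_norm p x + lp_norm p y + e" .
  qed
qed

lemma lp_uminus: "x \<in> lp_space p \<Longrightarrow> (\<lambda>n. - x n) \<in> lp_space p"
  by (simp add: lp_space_def)

lemma lp_diff:
  assumes "1 \<le> p" "x \<in> lp_space p" "y \<in> lp_space p"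
  shows "(\<lambda>n. x n - y n) \<in> lp_space p"
  using lp_add(1)[OF assms(1,2) lp_uminus[OF assms(3)]] by simp

lemma Metric_space_lp:
  assumes p: "1 \<le> p"
  shows "Metric_space (lp_space p) (lp_dist p)"
proof
  show "0 \<le> lp_dist p x y" for x y by (simp add: lp_dist_def lp_norm_def)
  show "lp_dist p x y = lp_dist p y x" for x y
    by (simp add: lp_dist_def lp_norm_def abs_minus_commute)
  show "lp_dist p x y = 0 \<longleftrightarrow> x = y" if "x \<in> lp_space p" "y \<in> lp_space p" for x y
  proof -
    have "summable (\<lambda>n. \<bar>x n - y n\<bar> powr p)"
      using lp_diff[OF p that] by (simp add: lp_space_def)
    then have "(\<Sum>n. \<bar>x n - y n\<bar> powr p) = 0 \<longleftrightarrow> (\<forall>n. \<bar>x n - y n\<bar> powr p = 0)"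
      by (intro suminf_eq_zero_iff) auto
    then show ?thesis by (auto simp: lp_dist_def lp_norm_def)
  qed
  show "lp_dist p x z \<le> lp_dist p x y + lp_dist p y z"
    if "x \<in> lp_space p" "y \<in> lp_space p" "z \<in> lp_space p" for x y z
    using lp_add(2)[OF p lp_diff[OF p that(1,2)] lp_diff[OF p that(2,3)]]
    by (simp add: lp_dist_def)
qed

lemma mspace_lp_metric [simp]: "1 \<le> p \<Longrightarrow> mspace (lp_metric p) = lp_space p"
  and mdist_lp_metric [simp]: "1 \<le> p \<Longrightarrow> mdist (lp_metric p) = lp_dist p"
  by (simp_all add: lp_metric_def Metric_space.mspace_metric Metric_space.mdist_metric
      Metric_space_lp)

definition tree_vertices :: "nat \<Rightarrow> nat list set" where
  "tree_vertices h = {s. length s \<le> h \<and> set s \<subseteq> {1..}}"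

definition tree_edges :: "nat \<Rightarrow> (nat list \<times> nat list) set" where
  "tree_edges h = {(s, t). s \<in> tree_vertices h \<and> t \<in> tree_vertices h \<and>
     (\<exists>n. t = s @ [n] \<or> s = t @ [n])}"

text \<open>The least number of edges of a walk from \<open>s\<close> to \<open>t\<close>.\<close>

definition path_dist :: "('a \<times> 'a) set \<Rightarrow> 'a \<Rightarrow> 'a \<Rightarrow> real" where
  "path_dist E s t = real (LEAST k. (s, t) \<in> E ^^ k)"

definition tree_metric :: "nat \<Rightarrow> nat list metric" where
  "tree_metric h = metric (tree_vertices h, path_dist (tree_edges h))"

lemma relpow_sym:
  assumes "sym E" "(s, t) \<in> E ^^ k"
  shows "(t, s) \<in> E ^^ k"
  using assms(2)
proof (induction k arbitrary: t)
  case (Suc k)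
  then obtain u where "(s, u) \<in> E ^^ k" "(u, t) \<in> E" by auto
  then show ?case using Suc.IH \<open>sym E\<close> by (meson relpow_Suc_I2 symD)
qed simp

lemma Metric_space_path_dist:
  assumes E: "sym E" and con: "\<And>s t. s \<in> V \<Longrightarrow> t \<in> V \<Longrightarrow> (s, t) \<in> E\<^sup>*"
  shows "Metric_space V (path_dist E)"
proof
  have walk: "(s, t) \<in> E ^^ (LEAST k. (s, t) \<in> E ^^ k)" if "s \<in> V" "t \<in> V" for s t
    using con[OF that] by (metis LeastI rtrancl_imp_relpow)
  show "0 \<le> path_dist E s t" for s t by (simp add: path_dist_def)
  show "path_dist E s t = path_dist E t s" for s t
    unfolding path_dist_def using relpow_sym[OF E] by metis
  show "path_dist E s t = 0 \<longleftrightarrow> s = t" if "s \<in> V" "t \<in> V" for s t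
  proof
    assume "path_dist E s t = 0"
    then show "s = t" using walk[OF that] by (simp add: path_dist_def)
  next
    assume "s = t"
    then have "(LEAST k. (s, t) \<in> E ^^ k) \<le> 0" by (intro Least_le) simp
    then show "path_dist E s t = 0" by (simp add: path_dist_def)
  qed
  show "path_dist E s u \<le> path_dist E s t + path_dist E t u"
    if "s \<in> V" "t \<in> V" "u \<in> V" for s t u
  proof -
    have "(s, u) \<in> E ^^ ((LEAST k. (s, t) \<in> E ^^ k) + (LEAST k. (t, u) \<in> E ^^ k))"
      using walk that by (auto simp: relpow_add)
    from Least_le[of "\<lambda>k. (s, u) \<in> E ^^ k", OF this] show ?thesis
      unfolding path_dist_def by linarith
  qed
qed

lemma Metric_space_tree: "Metric_space (tree_vertices h) (path_dist (tree_edges h))"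
proof (rule Metric_space_path_dist)
  show sym: "sym (tree_edges h)" by (auto simp: sym_def tree_edges_def)
  have root: "([], s) \<in> (tree_edges h)\<^sup>*" if "s \<in> tree_vertices h" for s
    using that
  proof (induction s rule: rev_induct)
    case (snoc n s)
    then have "s \<in> tree_vertices h" by (simp add: tree_vertices_def)
    then have "(s, s @ [n]) \<in> tree_edges h"
      using snoc.prems by (auto simp: tree_edges_def)
    then show ?case using snoc.IH[OF \<open>s \<in> tree_vertices h\<close>] by (rule rtrancl_into_rtrancl[rotated])
  qed simp
  show "(s, t) \<in> (tree_edges h)\<^sup>*" if "s \<in> tree_vertices h" "t \<in> tree_vertices h" for s t
    using root[OF that(1)] root[OF that(2)] sym by (meson rtrancl_trans sym_rtrancl symD)
qed

lemma mspace_tree_metric [simp]: "mspace (tree_metric h) = tree_vertices h"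
  and mdist_tree_metric [simp]: "mdist (tree_metric h) = path_dist (tree_edges h)"
  by (simp_all add: tree_metric_def Metric_space.mspace_metric Metric_space.mdist_metric
      Metric_space_tree)

end

theory Submission
  imports Defs "HOL-Library.Sublist" "HOL-Real_Asymp.Real_Asymp"
begin

text \<open>
  The countably branching tree of height \<open>h\<close> needs distortion at least of order
  \<open>(log h) powr (1/p)\<close> in \<open>\<ell>\<^sub>p\<close>, whereas its finite subsets need only distortion of order
  \<open>(log h) powr (1/2)\<close>. For \<open>1 < p < 2\<close> the quotient of the two is unbounded.

  The lower bound comes from infinite branching. In \<open>\<ell>\<^sub>p\<close>, infinitely many separated vectors must
  have a definite part of their mass far out, where it cannot be aligned with a given vector
  (\<open>lp_fork\<close>). So below every child of a vertex \<open>v\<close> there is a grandchild whose image is closer to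
  the image of \<open>v\<close> than two edges would allow. These grandchildren span a copy of the tree of half
  the height with distances doubled, and after rescaling the \<open>p\<close>-th power of the Lipschitz constant
  has dropped by a fixed amount (\<open>tree_embedding_halve\<close>). As this can be repeated \<open>m\<close> times for
  height \<open>2 ^ m\<close>, the \<open>p\<close>-th power of the distortion is at least a constant times \<open>m\<close>
  (\<open>tree_distortion_lower_bound\<close>).

  For the upper bound, Bourgain's map into Hilbert space gives a vertex the coordinate
  \<open>sqrt (1 + i)\<close> at its ancestor \<open>i\<close> generations up. Its distortion is of the order of the square
  root of a harmonic sum of length \<open>h\<close>. Finite sets of vertices use finitely many coordinates, and
  by Khintchine's inequality sums with random signs embed finite-dimensional Hilbert spaces in
  \<open>\<ell>\<^sub>p\<close> with distortion independent of the dimension (\<open>finite_Hilbert_into_lp\<close>). Hence the tree of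
  height \<open>2 ^ m\<close> is \<open>48 * sqrt (m + 2)\<close>-finitely representable in \<open>\<ell>\<^sub>p\<close>.
\<close>

section \<open>The distance between two vertices\<close>

text \<open>The number of entries of \<open>s\<close> and \<open>t\<close> after their longest common prefix. The recursive form
  makes inductions short, and \<open>path_dist_tree\<close> below identifies it with the distance in the tree.\<close>

fun tree_dist :: "'a list \<Rightarrow> 'a list \<Rightarrow> nat" where
  "tree_dist [] t = length t"
| "tree_dist s [] = length s"
| "tree_dist (a # s) (b # t) = (if a = b then tree_dist s t else 2 + length s + length t)"

lemma tree_dist_Nil2 [simp]: "tree_dist s [] = length s"
  by (cases s) auto

lemma tree_dist_append [simp]: "tree_dist (u @ s) (u @ t) = tree_dist s t"
  by (induction u) auto

lemma tree_dist_snoc: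
  "tree_dist s (t @ [n]) \<le> Suc (tree_dist s t)" "tree_dist s t \<le> Suc (tree_dist s (t @ [n]))"
  by (induction s t rule: tree_dist.induct) auto

lemma tree_dist_split:
  obtains u s' t' where "s = u @ s'" "t = u @ t'" "tree_dist s t = length s' + length t'"
    "s' = [] \<or> t' = [] \<or> hd s' \<noteq> hd t'"
proof -
  have "\<exists>u s' t'. s = u @ s' \<and> t = u @ t' \<and> tree_dist s t = length s' + length t' \<and>
      (s' = [] \<or> t' = [] \<or> hd s' \<noteq> hd t')"
  proof (induction s t rule: tree_dist.induct)
    case (3 a s b t)
    show ?case
    proof (cases "a = b")
      case True
      then obtain u s' t' where "s = u @ s'" "t = u @ t'" "tree_dist s t = length s' + length t'"
        "s' = [] \<or> t' = [] \<or> hd s' \<noteq> hd t'"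
        using 3 by blast
      then show ?thesis using True
        by (intro exI[of _ "a # u"] exI[of _ s'] exI[of _ t']) auto
    next
      case False
      then show ?thesis by (intro exI[of _ "[]"] exI[of _ "a # s"] exI[of _ "b # t"]) auto
    qed
  qed auto
  then show thesis using that by blast
qed

lemma tree_edge_snoc:
  "s @ [n] \<in> tree_vertices h \<Longrightarrow> (s, s @ [n]) \<in> tree_edges h"
  by (auto simp: tree_edges_def tree_vertices_def)

lemma sym_tree_edges: "sym (tree_edges h)"
  by (auto simp: sym_def tree_edges_def)

lemma tree_walk_down:
  "u @ r \<in> tree_vertices h \<Longrightarrow> (u, u @ r) \<in> tree_edges h ^^ length r"
proof (induction r rule: rev_induct)
  case (snoc n r)
  then have "u @ r \<in> tree_vertices h" by (auto simp: tree_vertices_def)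
  moreover have "(u @ r, u @ r @ [n]) \<in> tree_edges h"
    using tree_edge_snoc[of "u @ r" n h] snoc.prems by simp
  ultimately show ?case using snoc.IH by auto
qed simp

text \<open>Along an edge the last vertex of a walk gains or loses one entry, which changes its
  \<open>tree_dist\<close> from \<open>s\<close> by at most one.\<close>

lemma tree_walk_length:
  "(s, t) \<in> tree_edges h ^^ k \<Longrightarrow> tree_dist s t \<le> k"
proof (induction k arbitrary: t)
  case 0
  then show ?case using tree_dist_append[of s "[]" "[]"] by simp
next
  case (Suc k)
  then obtain v where v: "(s, v) \<in> tree_edges h ^^ k" "(v, t) \<in> tree_edges h" by auto
  from v(2) obtain n where "t = v @ [n] \<or> v = t @ [n]" by (auto simp: tree_edges_def)
  then have "tree_dist s t \<le> Suc (tree_dist s v)" using tree_dist_snoc by metis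
  then show ?case using Suc.IH[OF v(1)] by simp
qed

text \<open>The geodesic climbs from \<open>s\<close> to the longest common prefix and then descends to \<open>t\<close>.\<close>

lemma tree_walk_shortest:
  assumes s: "s \<in> tree_vertices h" and t: "t \<in> tree_vertices h"
  shows "(s, t) \<in> tree_edges h ^^ tree_dist s t"
proof -
  obtain u s' t' where d: "s = u @ s'" "t = u @ t'" "tree_dist s t = length s' + length t'"
    by (rule tree_dist_split)
  have "(s, u) \<in> tree_edges h ^^ length s'"
    unfolding d(1) by (rule relpow_sym[OF sym_tree_edges tree_walk_down]) (use s d(1) in simp)
  moreover have "(u, t) \<in> tree_edges h ^^ length t'"
    unfolding d(2) by (rule tree_walk_down) (use t d(2) in simp)
  ultimately show ?thesis
    unfolding d(3) relpow_add by (rule relcompI)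
qed

lemma path_dist_tree:
  assumes "s \<in> tree_vertices h" "t \<in> tree_vertices h"
  shows "path_dist (tree_edges h) s t = real (tree_dist s t)"
  unfolding path_dist_def
  by (rule arg_cong[of _ _ real], rule Least_equality)
    (fact tree_walk_shortest[OF assms], rule tree_walk_length)

section \<open>Distortion and two-sided Lipschitz bounds\<close>

lemma Lip_bounds:
  assumes "0 \<le> b"
    "\<And>x y. x \<in> mspace X \<Longrightarrow> y \<in> mspace X \<Longrightarrow> mdist Y (f x) (f y) \<le> b * mdist X x y"
  shows "0 \<le> Lip X Y f" "Lip X Y f \<le> b"
  unfolding Lip_def using assms
  by (auto intro!: cInf_greatest cInf_lower bdd_belowI[of _ 0])

text \<open>The infimum is itself an admissible constant, because each condition on \<open>L\<close> is a closed one.\<close>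

lemma Lip_attained:
  assumes f: "Lipschitz_continuous_map X Y f"
  shows "0 \<le> Lip X Y f"
    and "\<And>x y. x \<in> mspace X \<Longrightarrow> y \<in> mspace X \<Longrightarrow> mdist Y (f x) (f y) \<le> Lip X Y f * mdist X x y"
proof -
  obtain b where b: "0 < b" "\<And>x y. x \<in> mspace X \<Longrightarrow> y \<in> mspace X \<Longrightarrow>
      mdist Y (f x) (f y) \<le> b * mdist X x y"
    using f unfolding Lipschitz_continuous_map_pos by blast
  then show "0 \<le> Lip X Y f" by (intro Lip_bounds(1)[of b]) auto
  fix x y assume xy: "x \<in> mspace X" "y \<in> mspace X"
  show "mdist Y (f x) (f y) \<le> Lip X Y f * mdist X x y"
  proof (cases "mdist X x y = 0")
    case True
    then show ?thesis using b(2)[OF xy] by simp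
  next
    case False
    then have pos: "0 < mdist X x y" by (simp add: less_le)
    have "mdist Y (f x) (f y) / mdist X x y \<le> Lip X Y f"
      unfolding Lip_def
    proof (rule cInf_greatest)
      show "{L. 0 \<le> L \<and> (\<forall>x\<in>mspace X. \<forall>y\<in>mspace X. mdist Y (f x) (f y) \<le> L * mdist X x y)} \<noteq> {}"
        using b less_imp_le[OF b(1)] by blast
    qed (use pos xy in \<open>auto simp: pos_divide_le_eq\<close>)
    then show ?thesis using pos by (simp add: pos_divide_le_eq)
  qed
qed

text \<open>Together with \<open>c_dist_less_imp_embedding\<close>, this replaces the distortion of a bi-Lipschitz
  embedding by a pair of inequalities between distances.\<close>

lemma c_dist_le:
  assumes f: "f \<in> mspace X \<rightarrow> mspace Y" and a: "0 < a" and b: "0 \<le> b"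
    and lower: "\<And>x y. x \<in> mspace X \<Longrightarrow> y \<in> mspace X \<Longrightarrow> a * mdist X x y \<le> mdist Y (f x) (f y)"
    and upper: "\<And>x y. x \<in> mspace X \<Longrightarrow> y \<in> mspace X \<Longrightarrow> mdist Y (f x) (f y) \<le> b * mdist X x y"
  shows "c_dist Y X \<le> ereal (b / a)"
proof -
  let ?Z = "submetric Y (f ` mspace X)" and ?g = "inv_into (mspace X) f"
  have inj: "inj_on f (mspace X)"
  proof (rule inj_onI)
    fix x y assume xy: "x \<in> mspace X" "y \<in> mspace X" "f x = f y"
    have "f y \<in> mspace Y" using f xy(2) by blast
    then have "mdist Y (f x) (f y) = 0" using xy(3) by simp
    then have "a * mdist X x y \<le> 0" using lower[OF xy(1,2)] by simp
    then have "mdist X x y \<le> 0" using a by (simp add: mult_le_0_iff)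
    then show "x = y" using xy by (metis mdist_nonneg mdist_zero order_antisym)
  qed
  have Z: "mspace ?Z = f ` mspace X" using f by (auto simp: mspace_submetric)
  have inv: "mdist X (?g v) (?g w) \<le> 1 / a * mdist ?Z v w"
    if vw: "v \<in> mspace ?Z" "w \<in> mspace ?Z" for v w
  proof -
    obtain x y where "x \<in> mspace X" "y \<in> mspace X" "v = f x" "w = f y"
      using vw unfolding Z by blast
    then show ?thesis
      using lower[of x y] inj a by (simp add: mdist_submetric pos_le_divide_eq mult.commute)
  qed
  have "Lipschitz_continuous_map X Y f"
    unfolding Lipschitz_continuous_map_def using f upper by blast
  moreover have "Lipschitz_continuous_map ?Z X ?g"
    unfolding Lipschitz_continuous_map_def
  proof (intro conjI exI[of _ "1 / a"] ballI)
    show "?g \<in> mspace ?Z \<rightarrow> mspace X" unfolding Z by (simp add: inv_into_into)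
  qed (rule inv)
  ultimately have "bi_Lipschitz_embedding X Y f"
    using inj by (simp add: bi_Lipschitz_embedding_def)
  moreover have "distortion X Y f \<le> b * (1 / a)"
    unfolding distortion_def
  proof (rule mult_mono)
    show "Lip X Y f \<le> b" using b upper by (rule Lip_bounds)
    show "Lip ?Z X ?g \<le> 1 / a" using _ inv by (rule Lip_bounds) (use a in simp)
    show "0 \<le> Lip ?Z X ?g" using _ inv by (rule Lip_bounds) (use a in simp)
  qed (fact b)
  ultimately show ?thesis
    unfolding c_dist_def by (intro INF_lower2[of f]) auto
qed

lemma c_dist_less_imp_embedding:
  assumes "c_dist Y X < ereal K"
  obtains f A B where "f \<in> mspace X \<rightarrow> mspace Y" "0 \<le> A" "0 \<le> B" "A * B < K"
    "\<And>x y. x \<in> mspace X \<Longrightarrow> y \<in> mspace X \<Longrightarrow> mdist Y (f x) (f y) \<le> B * mdist X x y"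
    "\<And>x y. x \<in> mspace X \<Longrightarrow> y \<in> mspace X \<Longrightarrow> mdist X x y \<le> A * mdist Y (f x) (f y)"
proof -
  obtain f where f: "bi_Lipschitz_embedding X Y f" and K: "distortion X Y f < K"
    using assms unfolding c_dist_def INF_less_iff by auto
  let ?Z = "submetric Y (f ` mspace X)" and ?g = "inv_into (mspace X) f"
  have f': "inj_on f (mspace X)" "Lipschitz_continuous_map X Y f" "Lipschitz_continuous_map ?Z X ?g"
    using f by (auto simp: bi_Lipschitz_embedding_def)
  have im: "f \<in> mspace X \<rightarrow> mspace Y" using f'(2) by (rule Lipschitz_continuous_map_image)
  have Z: "mspace ?Z = f ` mspace X" using im by (auto simp: mspace_submetric)
  show thesis
  proof (rule that[of f "Lip ?Z X ?g" "Lip X Y f"])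
    show "Lip ?Z X ?g * Lip X Y f < K" using K by (simp add: distortion_def mult.commute)
    fix x y assume xy: "x \<in> mspace X" "y \<in> mspace X"
    then have "f x \<in> mspace ?Z" "f y \<in> mspace ?Z" unfolding Z by simp_all
    then have "mdist X (?g (f x)) (?g (f y)) \<le> Lip ?Z X ?g * mdist ?Z (f x) (f y)"
      by (rule Lip_attained(2)[OF f'(3)])
    then show "mdist X x y \<le> Lip ?Z X ?g * mdist Y (f x) (f y)"
      using f'(1) xy by (simp add: mdist_submetric)
  qed (fact im, fact Lip_attained(1)[OF f'(3)], fact Lip_attained(1)[OF f'(2)],
      fact Lip_attained(2)[OF f'(2)])
qed

section \<open>Forks in \<open>\<ell>\<^sub>p\<close>\<close>

text \<open>The \<open>p\<close>-th power of the norm. It is additive over disjoint sets of coordinates, and bounds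
  improve linearly in it, which keeps the recursion on the height of a tree additive.\<close>

definition lp_pow :: "real \<Rightarrow> (nat \<Rightarrow> real) \<Rightarrow> real" where
  "lp_pow p x = (\<Sum>n. \<bar>x n\<bar> powr p)"

lemma lp_pow_nonneg: "x \<in> lp_space p \<Longrightarrow> 0 \<le> lp_pow p x"
  unfolding lp_pow_def lp_space_def by (auto intro: suminf_nonneg)

lemma lp_norm_nonneg [simp]: "0 \<le> lp_norm p x"
  by (simp add: lp_norm_def)

lemma lp_norm_powr:
  "0 < p \<Longrightarrow> x \<in> lp_space p \<Longrightarrow> lp_norm p x powr p = lp_pow p x"
  using lp_pow_nonneg[of x p] by (simp add: lp_norm_def lp_pow_def[symmetric] powr_powr)

lemma lp_norm_le_iff:
  assumes "0 < p" "x \<in> lp_space p" "0 \<le> D"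
  shows "lp_norm p x \<le> D \<longleftrightarrow> lp_pow p x \<le> D powr p"
  using assms powr_less_mono2[of p D "lp_norm p x"] powr_mono2[of p "lp_norm p x" D]
  by (fastforce simp: lp_norm_powr[symmetric])

lemma lp_norm_ge_iff:
  assumes "0 < p" "x \<in> lp_space p" "0 \<le> D"
  shows "D \<le> lp_norm p x \<longleftrightarrow> D powr p \<le> lp_pow p x"
  using assms powr_less_mono2[of p "lp_norm p x" D] powr_mono2[of p D "lp_norm p x"]
  by (fastforce simp: lp_norm_powr[symmetric])

lemma lp_scale:
  assumes "x \<in> lp_space p"
  shows "(\<lambda>n. c * x n) \<in> lp_space p" "lp_pow p (\<lambda>n. c * x n) = \<bar>c\<bar> powr p * lp_pow p x"
  using assms unfolding lp_space_def lp_pow_def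
  by (auto simp: abs_mult powr_mult intro: summable_mult suminf_mult)

lemma lp_pow_minus_commute: "lp_pow p (\<lambda>n. x n - y n) = lp_pow p (\<lambda>n. y n - x n)"
  unfolding lp_pow_def by (simp add: abs_minus_commute)

lemma lp_norm_diff:
  assumes "1 \<le> p" "x \<in> lp_space p" "y \<in> lp_space p"
  shows "lp_norm p (\<lambda>n. x n - y n) \<le> lp_norm p x + lp_norm p y"
  using lp_add(2)[OF assms(1,2) lp_uminus[OF assms(3)]] by (simp add: lp_norm_def)

definition lp_head :: "nat \<Rightarrow> (nat \<Rightarrow> real) \<Rightarrow> nat \<Rightarrow> real" where
  "lp_head N x = (\<lambda>i. if i < N then x i else 0)"

definition lp_tail :: "nat \<Rightarrow> (nat \<Rightarrow> real) \<Rightarrow> nat \<Rightarrow> real" where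
  "lp_tail N x = (\<lambda>i. if i < N then 0 else x i)"

lemma lp_pow_head: "lp_pow p (lp_head N x) = (\<Sum>i<N. \<bar>x i\<bar> powr p)"
proof -
  have "(\<Sum>n. \<bar>lp_head N x n\<bar> powr p) = (\<Sum>n\<in>{..<N}. \<bar>lp_head N x n\<bar> powr p)"
    by (rule suminf_finite) (auto simp: lp_head_def)
  then show ?thesis by (simp add: lp_pow_def lp_head_def)
qed

lemma lp_head_in: "lp_head N x \<in> lp_space p"
  unfolding lp_space_def by (auto intro!: summable_finite[of "{..<N}"] simp: lp_head_def split: if_splits)

lemma lp_tail_in:
  assumes "x \<in> lp_space p" shows "lp_tail N x \<in> lp_space p"
  using assms unfolding lp_space_def
  by (auto intro!: summable_comparison_test'[of "\<lambda>n. \<bar>x n\<bar> powr p"] simp: lp_tail_def)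

lemma lp_pow_split:
  assumes "x \<in> lp_space p"
  shows "lp_pow p x = lp_pow p (lp_head N x) + lp_pow p (lp_tail N x)"
proof -
  have "summable (\<lambda>n. \<bar>lp_head N x n\<bar> powr p)" "summable (\<lambda>n. \<bar>lp_tail N x n\<bar> powr p)"
    using lp_head_in lp_tail_in[OF assms] by (auto simp: lp_space_def)
  then show ?thesis unfolding lp_pow_def
    by (subst suminf_add) (auto intro!: suminf_cong simp: lp_head_def lp_tail_def)
qed

lemma lp_tail_small:
  assumes x: "x \<in> lp_space p" and e: "0 < e"
  obtains N where "lp_pow p (lp_tail N x) < e"
proof -
  have "(\<lambda>N. \<Sum>i<N. \<bar>x i\<bar> powr p) \<longlonglongrightarrow> lp_pow p x"
    using x summable_LIMSEQ unfolding lp_space_def lp_pow_def by auto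
  then have "\<forall>\<^sub>F N in sequentially. lp_pow p x - e < (\<Sum>i<N. \<bar>x i\<bar> powr p)"
    using e by (intro order_tendstoD(1)) auto
  then obtain N where "lp_pow p x - e < (\<Sum>i<N. \<bar>x i\<bar> powr p)"
    by (auto simp: eventually_sequentially)
  then show thesis
    using that[of N] lp_pow_split[OF x, of N] by (simp add: lp_pow_head)
qed

lemma coordinate_le_lp_pow:
  assumes "0 < p" "x \<in> lp_space p" "lp_pow p x \<le> L"
  shows "\<bar>x i\<bar> \<le> L powr (1 / p)"
proof -
  have "\<bar>x i\<bar> powr p \<le> lp_pow p x"
    using assms(2) sum_le_suminf[of "\<lambda>n. \<bar>x n\<bar> powr p" "{i}"]
    by (auto simp: lp_space_def lp_pow_def)
  then have "(\<bar>x i\<bar> powr p) powr (1 / p) \<le> L powr (1 / p)"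
    using assms by (intro powr_mono2) auto
  then show ?thesis using assms(1) by (simp add: powr_powr)
qed

text \<open>Rounding the first \<open>N\<close> coordinates to multiples of \<open>e\<close> leaves finitely many values, so two
  vectors of the sequence round alike.\<close>

lemma bounded_sequence_close_heads:
  fixes z :: "nat \<Rightarrow> nat \<Rightarrow> real"
  assumes bd: "\<And>n i. \<bar>z n i\<bar> \<le> B" and e: "0 < e"
  obtains n m where "n \<noteq> m" "\<And>i. i < N \<Longrightarrow> \<bar>z n i - z m i\<bar> < e"
proof -
  define c where "c n = restrict (\<lambda>i. \<lfloor>z n i / e\<rfloor>) {..<N}" for n
  have "- B / e \<le> z n i / e \<and> z n i / e \<le> B / e" for n i
    using bd[of n i] e by (intro conjI divide_right_mono) linarith+
  then have "range c \<subseteq> PiE {..<N} (\<lambda>_. {\<lfloor>- B / e\<rfloor>..\<lfloor>B / e\<rfloor>})"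
    unfolding c_def by (auto intro!: floor_mono split: if_splits simp del: minus_divide_left)
  then have "finite (range c)" by (rule finite_subset) (auto intro: finite_PiE)
  then have "\<not> inj c" using finite_imageD infinite_UNIV_nat by blast
  then obtain n m where nm: "n \<noteq> m" "c n = c m" by (auto simp: inj_def)
  have "\<bar>z n i - z m i\<bar> < e" if "i < N" for i
  proof -
    have "\<lfloor>z n i / e\<rfloor> = \<lfloor>z m i / e\<rfloor>"
      using fun_cong[OF nm(2), of i] that by (simp add: c_def)
    then have "\<bar>z n i / e - z m i / e\<bar> < 1" by linarith
    then show ?thesis using e by (simp add: diff_divide_distrib[symmetric])
  qed
  then show thesis using that nm by blast
qed

text \<open>Half of the quantity \<open>2 powr (p - 1) - 1\<close>, the slack in convexity of \<open>t powr p\<close>, times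
  \<open>(1/2) powr p\<close>, a lower bound for the mass of a tail, divided by \<open>2 powr p\<close> because
  passing to every second level of a tree doubles the distances.\<close>

definition fork_gain :: "real \<Rightarrow> real" where
  "fork_gain p = (2 powr (p - 1) - 1) / 2 powr (2 * p + 1)"

lemma fork_gain_pos: "1 < p \<Longrightarrow> 0 < fork_gain p"
  by (simp add: fork_gain_def)

text \<open>Convexity of \<open>t powr p\<close> at the midpoint of \<open>a\<close> and \<open>b\<close>.\<close>

lemma powr_add_le:
  fixes a b p :: real
  assumes "1 \<le> p" "0 \<le> a" "0 \<le> b"
  shows "(a + b) powr p \<le> 2 powr (p - 1) * (a powr p + b powr p)"
proof -
  have "((1 - 1/2) *\<^sub>R a + (1/2) *\<^sub>R b) powr p \<le> (1 - 1/2) * a powr p + (1/2) * b powr p"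
    using assms by (intro convex_onD[OF convex_on_powr_nonneg]) auto
  also have "(1 - 1/2) *\<^sub>R a + (1/2) *\<^sub>R b = (a + b) / 2" by simp
  finally have "((a + b) / 2) powr p \<le> (a powr p + b powr p) / 2"
    by (simp add: add_divide_distrib)
  then have "(a + b) powr p / 2 powr p \<le> (a powr p + b powr p) / 2"
    using assms by (subst (asm) powr_divide) auto
  then have "2 powr p * ((a + b) powr p / 2 powr p) \<le> 2 powr p * ((a powr p + b powr p) / 2)"
    by (intro mult_left_mono) auto
  then show ?thesis by (simp add: powr_diff)
qed

text \<open>A quantitative form of Rolewicz's property \<open>(\<beta>)\<close> for \<open>\<ell>\<^sub>p\<close>: a vector in a ball cannot be
  almost diametrically opposite to every member of a separated sequence in that ball.

  The vector \<open>u\<close> lives essentially on finitely many coordinates. On these, two members of the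
  sequence are within distance \<open>1\<close>, so one of them, \<open>z k\<close>, has a tail of norm \<open>q \<ge> 1/2\<close>. Its head then has
  norm \<open>t\<close> with \<open>t powr p \<le> L - q powr p\<close>. Only the head can be opposite to \<open>u\<close>, whereas head and
  tail contribute to the \<open>p\<close>-th power of the norm separately. For \<open>D powr p = L\<close> this gives, up to
  a small error, the bound \<open>(D + t) powr p + q powr p\<close>, which by convexity is at most
  \<open>2 powr p * L - (2 powr (p - 1) - 1) * q powr p\<close>.\<close>

lemma lp_fork:
  fixes p L :: real and z :: "nat \<Rightarrow> nat \<Rightarrow> real"
  assumes p: "1 < p"
    and u: "u \<in> lp_space p" "lp_pow p u \<le> L"
    and z: "\<And>n. z n \<in> lp_space p" "\<And>n. lp_pow p (z n) \<le> L"
    and sep: "\<And>n m. n \<noteq> m \<Longrightarrow> 2 powr p \<le> lp_pow p (\<lambda>i. z n i - z m i)"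
  obtains n where "lp_pow p (\<lambda>i. u i - z n i) \<le> 2 powr p * (L - fork_gain p)"
proof -
  define \<kappa> where "\<kappa> = 2 powr (p - 1) - 1"
  have \<kappa>: "0 < \<kappa>" using p by (simp add: \<kappa>_def)
  have c: "2 powr (p - 1) = \<kappa> + 1" "2 powr p = 2 * (\<kappa> + 1)"
    by (simp_all add: \<kappa>_def powr_diff)
  have "2 powr (2 * p + 1) = 2 powr p * 2 powr (p + 1)"
    unfolding powr_add[symmetric] by (simp add: algebra_simps)
  then have gain: "2 powr p * fork_gain p = \<kappa> / 2 powr (p + 1)"
    unfolding fork_gain_def \<kappa>_def[symmetric] by simp
  define D where "D = L powr (1 / p)"
  have D0: "0 \<le> D" by (simp add: D_def)
  have L0: "0 \<le> L" using lp_pow_nonneg[OF u(1)] u(2) by linarith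
  have Dp: "D powr p = L" using L0 p by (simp add: D_def powr_powr)
  have "uniformly_continuous_on {0..D + 1} (\<lambda>t. t powr p)"
    using p by (intro compact_uniformly_continuous continuous_on_powr') (auto intro!: continuous_intros)
  then obtain d where d: "0 < d" and
    dd: "\<And>s t. s \<in> {0..D+1} \<Longrightarrow> t \<in> {0..D+1} \<Longrightarrow> dist t s < d \<Longrightarrow>
      dist (t powr p) (s powr p) < \<kappa> / 2 powr (p + 1)"
    using \<kappa> unfolding uniformly_continuous_on_def by (metis (no_types, lifting) divide_pos_pos powr_gt_zero zero_neq_numeral)
  \<comment> \<open>An error \<open>\<delta>\<close> in the norm of a tail must cost less than half of the gain, uniformly for
    norms up to \<open>D\<close>.\<close>
  define \<delta> where "\<delta> = min (d / 2) 1"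
  have \<delta>: "0 < \<delta>" "\<delta> \<le> 1" "\<delta> < d" using d by (auto simp: \<delta>_def)
  have incr: "(q + \<delta>) powr p \<le> q powr p + \<kappa> / 2 powr (p + 1)" if "0 \<le> q" "q \<le> D" for q
    using dd[of q "q + \<delta>"] that \<delta> by (auto simp: dist_real_def)
  obtain N where N: "lp_pow p (lp_tail N u) < \<delta> powr p"
    using lp_tail_small[OF u(1), of "\<delta> powr p"] \<delta> by auto
  \<comment> \<open>Coordinatewise closeness \<open>e\<close> makes the two heads differ by at most \<open>1\<close> in norm; this leaves
    at least \<open>2 powr p - 1 \<ge> 1\<close> of the separation to the tails.\<close>
  define e where "e = 1 / (real N + 1) powr (1 / p)"
  have e: "0 < e" by (simp add: e_def)
  obtain n m where nm: "n \<noteq> m" "\<And>i. i < N \<Longrightarrow> \<bar>z n i - z m i\<bar> < e"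
    using bounded_sequence_close_heads[of z D e N] coordinate_le_lp_pow[of p _ L] z p e
    unfolding D_def by (metis less_trans zero_less_one)
  have zz: "(\<lambda>i. z n i - z m i) \<in> lp_space p" using p z by (intro lp_diff) auto
  have "(\<Sum>i<N. \<bar>z n i - z m i\<bar> powr p) \<le> (\<Sum>i<N. e powr p)"
    using nm(2) p by (intro sum_mono powr_mono2) (auto intro: less_imp_le)
  also have "\<dots> = real N / (real N + 1)"
    using p by (simp add: e_def powr_divide powr_powr)
  also have "\<dots> \<le> 1" by simp
  finally have "2 powr p \<le> 1 + lp_pow p (lp_tail N (\<lambda>i. z n i - z m i))"
    using sep[OF nm(1)] lp_pow_split[OF zz, of N] by (simp add: lp_pow_head)
  moreover have "2 powr 1 \<le> 2 powr p" using p by (intro powr_mono) auto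
  ultimately have "1 powr p \<le> lp_pow p (lp_tail N (\<lambda>i. z n i - z m i))" by simp
  then have "1 \<le> lp_norm p (lp_tail N (\<lambda>i. z n i - z m i))"
    using p zz by (subst lp_norm_ge_iff) (auto intro: lp_tail_in)
  also have "lp_tail N (\<lambda>i. z n i - z m i) = (\<lambda>i. lp_tail N (z n) i - lp_tail N (z m) i)"
    by (auto simp: lp_tail_def)
  also have "lp_norm p \<dots> \<le> lp_norm p (lp_tail N (z n)) + lp_norm p (lp_tail N (z m))"
    using p z by (intro lp_norm_diff lp_tail_in) auto
  finally obtain k where k: "1 / 2 \<le> lp_norm p (lp_tail N (z k))"
    by (smt (verit) field_sum_of_halves)
  define q where "q = lp_norm p (lp_tail N (z k))"
  define t where "t = lp_norm p (lp_head N (z k))"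
  have tq: "t powr p + q powr p \<le> L"
    unfolding t_def q_def using p z(1) z(2)[of k] lp_pow_split[OF z(1), of k N]
    by (simp add: lp_norm_powr lp_head_in lp_tail_in)
  have t0: "0 \<le> t" and q0: "0 \<le> q" by (auto simp: t_def q_def)
  have qD: "q \<le> D"
  proof -
    have "q powr p \<le> D powr p" using tq Dp by (smt (verit) powr_ge_zero)
    then show ?thesis using p q0 D0 powr_less_mono2[of p D q] by fastforce
  qed
  have uz: "(\<lambda>i. u i - z k i) \<in> lp_space p" using p z u by (intro lp_diff) auto
  have hd: "lp_pow p (lp_head N (\<lambda>i. u i - z k i)) \<le> (D + t) powr p"
  proof -
    have "lp_head N (\<lambda>i. u i - z k i) = (\<lambda>i. lp_head N u i - lp_head N (z k) i)"
      by (auto simp: lp_head_def)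
    then have "lp_norm p (lp_head N (\<lambda>i. u i - z k i)) \<le> lp_norm p (lp_head N u) + t"
      unfolding t_def using lp_norm_diff[of p "lp_head N u" "lp_head N (z k)"] p lp_head_in by simp
    moreover have "lp_norm p (lp_head N u) \<le> D"
      using p D0 u lp_pow_split[OF u(1), of N] lp_pow_nonneg[OF lp_tail_in[OF u(1)], of N]
      by (subst lp_norm_le_iff) (auto simp: Dp lp_head_in)
    ultimately show ?thesis
      using p t0 D0 by (subst lp_norm_le_iff[symmetric]) (auto simp: lp_head_in)
  qed
  have tl: "lp_pow p (lp_tail N (\<lambda>i. u i - z k i)) \<le> (q + \<delta>) powr p"
  proof -
    have "lp_tail N (\<lambda>i. u i - z k i) = (\<lambda>i. lp_tail N u i - lp_tail N (z k) i)"
      by (auto simp: lp_tail_def)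
    then have "lp_norm p (lp_tail N (\<lambda>i. u i - z k i)) \<le> lp_norm p (lp_tail N u) + q"
      unfolding q_def
      using lp_norm_diff[of p "lp_tail N u" "lp_tail N (z k)"] p lp_tail_in u z by simp
    moreover have "lp_norm p (lp_tail N u) \<le> \<delta>"
      using p \<delta> u N by (subst lp_norm_le_iff) (auto simp: lp_tail_in)
    ultimately show ?thesis
      using p q0 \<delta> uz by (subst lp_norm_le_iff[symmetric]) (auto simp: lp_tail_in)
  qed
  have q2: "1 / 2 powr p \<le> q powr p"
    using powr_mono2[of p "1/2" q] k p by (simp add: q_def powr_divide)
  have "lp_pow p (\<lambda>i. u i - z k i) \<le> (D + t) powr p + (q + \<delta>) powr p"
    using hd tl lp_pow_split[OF uz, of N] by simp
  also have "(D + t) powr p \<le> 2 powr (p - 1) * (L + t powr p)"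
    using powr_add_le[of p D t] p D0 t0 by (simp add: Dp)
  also have "2 powr (p - 1) * (L + t powr p) \<le> 2 powr (p - 1) * (2 * L - q powr p)"
    using tq by (intro mult_left_mono) auto
  also have "(q + \<delta>) powr p \<le> q powr p + \<kappa> / 2 powr (p + 1)"
    using incr q0 qD by auto
  also have "2 powr (p - 1) * (2 * L - q powr p) + (q powr p + \<kappa> / 2 powr (p + 1)) =
      2 powr p * L - \<kappa> * q powr p + \<kappa> / 2 powr (p + 1)"
    unfolding c by (simp add: algebra_simps)
  also have "\<dots> \<le> 2 powr p * L - \<kappa> * (1 / 2 powr p) + \<kappa> / 2 powr (p + 1)"
    using \<kappa> q2 by (intro add_right_mono diff_left_mono mult_left_mono) auto
  also have "\<dots> = 2 powr p * L - \<kappa> / 2 powr (p + 1)"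
    by (simp add: powr_add)
  also have "\<dots> = 2 powr p * (L - fork_gain p)"
    using gain by (simp add: right_diff_distrib)
  finally show thesis using that by simp
qed

section \<open>Shrinking embedded trees\<close>

text \<open>The co-Lipschitz constant is normalised to \<open>1\<close>, and only the edges are bounded from above, in
  terms of \<open>p\<close>-th powers: the triangle inequality bounds the other distances, and the recursion
  below produces edge bounds only.\<close>

definition tree_embedding :: "real \<Rightarrow> nat \<Rightarrow> real \<Rightarrow> (nat list \<Rightarrow> nat \<Rightarrow> real) \<Rightarrow> bool" where
  "tree_embedding p h L f \<longleftrightarrow>
     (\<forall>s\<in>tree_vertices h. f s \<in> lp_space p) \<and>
     (\<forall>s k. s @ [k] \<in> tree_vertices h \<longrightarrow> lp_pow p (\<lambda>i. f s i - f (s @ [k]) i) \<le> L) \<and>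
     (\<forall>s\<in>tree_vertices h. \<forall>t\<in>tree_vertices h.
        real (tree_dist s t) powr p \<le> lp_pow p (\<lambda>i. f s i - f t i))"

lemma tree_embeddingD:
  assumes "tree_embedding p h L f"
  shows "s \<in> tree_vertices h \<Longrightarrow> f s \<in> lp_space p"
    and "s @ [k] \<in> tree_vertices h \<Longrightarrow> lp_pow p (\<lambda>i. f s i - f (s @ [k]) i) \<le> L"
    and "s \<in> tree_vertices h \<Longrightarrow> t \<in> tree_vertices h \<Longrightarrow>
      real (tree_dist s t) powr p \<le> lp_pow p (\<lambda>i. f s i - f t i)"
  using assms unfolding tree_embedding_def by blast+

text \<open>Every second level of a subtree: \<open>N v k\<close> is the child that is kept below the child \<open>k\<close> of
  \<open>v\<close>. A word \<open>s\<close> is read from \<open>v\<close> on, two generations per letter.\<close>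

definition skip_levels :: "(nat list \<Rightarrow> nat \<Rightarrow> nat) \<Rightarrow> nat list \<Rightarrow> nat list \<Rightarrow> nat list" where
  "skip_levels N = foldl (\<lambda>v k. v @ [k, N v k])"

lemma skip_levels_simps [simp]:
  "skip_levels N v [] = v"
  "skip_levels N v (k # s) = skip_levels N (v @ [k, N v k]) s"
  "skip_levels N v (s @ [k]) = skip_levels N v s @ [k, N (skip_levels N v s) k]"
  by (simp_all add: skip_levels_def)

lemma skip_levels_extends:
  "\<exists>r. skip_levels N v s = v @ r \<and> length r = 2 * length s"
proof (induction s arbitrary: v)
  case (Cons k s)
  then obtain r where "skip_levels N (v @ [k, N v k]) s = (v @ [k, N v k]) @ r"
    "length r = 2 * length s"
    by blast
  then show ?case by (intro exI[of _ "[k, N v k] @ r"]) simp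
qed simp

lemma tree_dist_skip_levels:
  "tree_dist (skip_levels N v s) (skip_levels N v t) = 2 * tree_dist s t"
proof (induction s t arbitrary: v rule: tree_dist.induct)
  case (1 t)
  obtain r where "skip_levels N v t = v @ r" "length r = 2 * length t"
    using skip_levels_extends by blast
  then show ?case using tree_dist_append[of v "[]" r] by simp
next
  case (2 a s)
  obtain r where "skip_levels N v (a # s) = v @ r" "length r = 2 * length (a # s)"
    using skip_levels_extends by blast
  then show ?case using tree_dist_append[of v r "[]"] by simp
next
  case (3 a s b t)
  show ?case
  proof (cases "a = b")
    case True
    then show ?thesis using 3 by simp
  next
    case False
    obtain r where r: "skip_levels N v (a # s) = (v @ [a, N v a]) @ r" "length r = 2 * length s"
      using skip_levels_extends[of N "v @ [a, N v a]" s] by auto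
    obtain r' where r': "skip_levels N v (b # t) = (v @ [b, N v b]) @ r'" "length r' = 2 * length t"
      using skip_levels_extends[of N "v @ [b, N v b]" t] by auto
    show ?thesis using False unfolding r r' by (simp add: r(2) r'(2))
  qed
qed

lemma skip_levels_vertex:
  assumes "\<And>v k. 1 \<le> N v k" "s \<in> tree_vertices h"
  shows "skip_levels N [] s \<in> tree_vertices (2 * h)"
proof -
  have "set (skip_levels N [] s) \<subseteq> {1..}"
    using assms by (induction s rule: rev_induct) (auto simp: tree_vertices_def)
  moreover have "length (skip_levels N [] s) = 2 * length s"
    using skip_levels_extends[of N "[]" s] by auto
  ultimately show ?thesis using assms by (auto simp: tree_vertices_def)
qed

text \<open>The fork with handle \<open>v\<close>, centre \<open>v @ [k]\<close> and prongs \<open>v @ [k, n]\<close> is translated so that its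
  centre is the origin. Distinct prongs are at distance \<open>2\<close>, as \<open>lp_fork\<close> requires.\<close>

lemma short_grandchild:
  assumes p: "1 < p" and f: "tree_embedding p h L f" and v: "v @ [k, 1] \<in> tree_vertices h"
  obtains n where "1 \<le> n"
    "lp_pow p (\<lambda>i. f v i - f (v @ [k, n]) i) \<le> 2 powr p * (L - fork_gain p)"
proof -
  have V: "v \<in> tree_vertices h" "v @ [k] \<in> tree_vertices h"
    "\<And>n. v @ [k, Suc n] \<in> tree_vertices h"
    using v by (auto simp: tree_vertices_def)
  note in_lp = tree_embeddingD(1)[OF f]
  define u where "u = (\<lambda>i. f v i - f (v @ [k]) i)"
  define z where "z n = (\<lambda>i. f (v @ [k, Suc n]) i - f (v @ [k]) i)" for n
  have "u \<in> lp_space p" "\<And>n. z n \<in> lp_space p"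
    unfolding u_def z_def using p V in_lp by (auto intro!: lp_diff)
  moreover have "lp_pow p u \<le> L"
    unfolding u_def by (rule tree_embeddingD(2)[OF f V(2)])
  moreover have "lp_pow p (z n) \<le> L" for n
  proof -
    have "lp_pow p (\<lambda>i. f (v @ [k]) i - f ((v @ [k]) @ [Suc n]) i) \<le> L"
      by (rule tree_embeddingD(2)[OF f]) (use V(3)[of n] in simp)
    then show ?thesis unfolding z_def by (subst lp_pow_minus_commute) simp
  qed
  moreover have "2 powr p \<le> lp_pow p (\<lambda>i. z n i - z m i)" if "n \<noteq> m" for n m
  proof -
    have "real (tree_dist (v @ [k, Suc n]) (v @ [k, Suc m])) powr p
      \<le> lp_pow p (\<lambda>i. f (v @ [k, Suc n]) i - f (v @ [k, Suc m]) i)"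
      by (rule tree_embeddingD(3)[OF f V(3) V(3)])
    then show ?thesis using that by (simp add: z_def)
  qed
  ultimately obtain n where "lp_pow p (\<lambda>i. u i - z n i) \<le> 2 powr p * (L - fork_gain p)"
    using lp_fork[OF p, of u L z] by blast
  then show thesis using that[of "Suc n"] by (simp add: u_def z_def)
qed

text \<open>Keep one short grandchild below every child. The kept vertices form a tree of half the height
  whose distances are doubled; halving the map restores the normalisation, while the edges, now
  short in comparison with \<open>2 powr p * L\<close>, have improved.\<close>

lemma tree_embedding_halve:
  assumes p: "1 < p" and f: "tree_embedding p (2 * h) L f"
  obtains g where "tree_embedding p h (L - fork_gain p) g"
proof -
  \<comment> \<open>Outside the tree only positivity is asked for, which keeps all entries of the selected words
    positive.\<close>
  define short where "short v k n \<longleftrightarrow> 1 \<le> n \<and> (v @ [k, 1] \<in> tree_vertices (2 * h) \<longrightarrow>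
      lp_pow p (\<lambda>i. f v i - f (v @ [k, n]) i) \<le> 2 powr p * (L - fork_gain p))" for v k n
  define N where "N v k = (SOME n. short v k n)" for v k
  have "\<exists>n. short v k n" for v k
  proof (cases "v @ [k, 1] \<in> tree_vertices (2 * h)")
    case True
    show ?thesis
      by (rule short_grandchild[OF p f True]) (auto simp: short_def)
  next
    case False
    then show ?thesis by (auto simp: short_def)
  qed
  then have "short v k (N v k)" for v k
    unfolding N_def by (rule someI_ex)
  then have N1: "\<And>v k. 1 \<le> N v k" and
    N: "\<And>v k. v @ [k, 1] \<in> tree_vertices (2 * h) \<Longrightarrow>
      lp_pow p (\<lambda>i. f v i - f (v @ [k, N v k]) i) \<le> 2 powr p * (L - fork_gain p)"
    by (auto simp: short_def)
  define \<phi> where "\<phi> = skip_levels N []"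
  define g where "g s = (\<lambda>i. 1/2 * f (\<phi> s) i)" for s
  have \<phi>: "\<phi> s \<in> tree_vertices (2 * h)" if "s \<in> tree_vertices h" for s
    unfolding \<phi>_def using skip_levels_vertex[of N] N1 that by blast
  have f_in: "f (\<phi> s) \<in> lp_space p" if "s \<in> tree_vertices h" for s
    by (rule tree_embeddingD(1)[OF f \<phi>[OF that]])
  have pow: "lp_pow p (\<lambda>i. g s i - g t i) = lp_pow p (\<lambda>i. f (\<phi> s) i - f (\<phi> t) i) / 2 powr p"
    if "s \<in> tree_vertices h" "t \<in> tree_vertices h" for s t
  proof -
    have "(\<lambda>i. f (\<phi> s) i - f (\<phi> t) i) \<in> lp_space p"
      using p f_in that by (intro lp_diff) auto
    then show ?thesis
      using lp_scale(2)[of "\<lambda>i. f (\<phi> s) i - f (\<phi> t) i" p "1/2"]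
      by (simp add: g_def powr_divide diff_divide_distrib)
  qed
  have "tree_embedding p h (L - fork_gain p) g"
    unfolding tree_embedding_def
  proof (intro conjI ballI allI impI)
    fix s assume "s \<in> tree_vertices h"
    then show "g s \<in> lp_space p" unfolding g_def by (intro lp_scale f_in)
  next
    fix s k assume sk: "s @ [k] \<in> tree_vertices h"
    then have s: "s \<in> tree_vertices h" by (auto simp: tree_vertices_def)
    have "\<phi> s @ [k, 1] \<in> tree_vertices (2 * h)"
      using \<phi>[OF sk] by (auto simp: \<phi>_def tree_vertices_def)
    from N[OF this] show "lp_pow p (\<lambda>i. g s i - g (s @ [k]) i) \<le> L - fork_gain p"
      using pow[OF s sk] by (simp add: \<phi>_def pos_divide_le_eq mult.commute)
  next
    fix s t assume st: "s \<in> tree_vertices h" "t \<in> tree_vertices h"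
    have "real (2 * tree_dist s t) powr p \<le> lp_pow p (\<lambda>i. f (\<phi> s) i - f (\<phi> t) i)"
      using tree_embeddingD(3)[OF f \<phi>[OF st(1)] \<phi>[OF st(2)]]
      by (simp add: \<phi>_def tree_dist_skip_levels)
    then show "real (tree_dist s t) powr p \<le> lp_pow p (\<lambda>i. g s i - g t i)"
      using pow[OF st] by (simp add: powr_mult pos_le_divide_eq mult.commute)
  qed
  then show thesis using that by blast
qed

text \<open>Each of the \<open>m\<close> halvings lowers the bound by \<open>fork_gain p\<close>, and the bound stays nonnegative.
  Hence the distortion of a tree of height \<open>h\<close> is at least of order \<open>(log h) powr (1/p)\<close>.\<close>

lemma tree_embedding_lower_bound:
  assumes p: "1 < p" and f: "tree_embedding p (2 ^ m) L f"
  shows "real m * fork_gain p \<le> L"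
  using f
proof (induction m arbitrary: L f)
  case 0
  have V: "[] \<in> tree_vertices (2 ^ 0)" "[] @ [1] \<in> tree_vertices (2 ^ 0)"
    by (auto simp: tree_vertices_def)
  show ?case
    using tree_embeddingD(3)[OF 0 V] tree_embeddingD(2)[OF 0 V(2)] by simp
next
  case (Suc m)
  obtain g where "tree_embedding p (2 ^ m) (L - fork_gain p) g"
    using tree_embedding_halve[OF p, of "2 ^ m" L f] Suc.prems by auto
  from Suc.IH[OF this] show ?case by (simp add: algebra_simps)
qed

section \<open>Finite-dimensional Hilbert spaces in \<open>\<ell>\<^sub>p\<close>\<close>

text \<open>A subset \<open>A\<close> encodes the choice of signs that is positive exactly on \<open>A\<close>. Averages over
  \<open>Pow W\<close> are expectations with respect to independent symmetric signs indexed by \<open>W\<close>.\<close>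

definition rademacher :: "'a set \<Rightarrow> 'a \<Rightarrow> real" where
  "rademacher A t = (if t \<in> A then 1 else - 1)"

definition signed_sum :: "'a set \<Rightarrow> ('a \<Rightarrow> real) \<Rightarrow> 'a set \<Rightarrow> real" where
  "signed_sum W a A = (\<Sum>t\<in>W. rademacher A t * a t)"

text \<open>Conditioning on the sign of \<open>x\<close>; both moment computations are inductions along this identity.\<close>

lemma sum_Pow_insert_signed_sum:
  assumes W: "finite W" "x \<notin> W"
  shows "(\<Sum>A\<in>Pow (insert x W). F (signed_sum (insert x W) a A)) =
    (\<Sum>A\<in>Pow W. F (signed_sum W a A - a x) + F (signed_sum W a A + a x))"
proof -
  have out: "signed_sum (insert x W) a A = signed_sum W a A - a x" if "A \<in> Pow W" for A
  proof -
    have "x \<notin> A" using that W by auto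
    then show ?thesis using W by (simp add: signed_sum_def rademacher_def)
  qed
  have inn: "signed_sum (insert x W) a (insert x A) = signed_sum W a A + a x" for A
  proof -
    have "(\<Sum>t\<in>W. rademacher (insert x A) t * a t) = (\<Sum>t\<in>W. rademacher A t * a t)"
      using W by (intro sum.cong) (auto simp: rademacher_def)
    then show ?thesis using W by (simp add: signed_sum_def) (simp add: rademacher_def)
  qed
  have inj: "inj_on (insert x) (Pow W)"
    using W by (auto simp: inj_on_def)
  have "(\<Sum>A\<in>Pow (insert x W). F (signed_sum (insert x W) a A)) =
     (\<Sum>A\<in>Pow W. F (signed_sum (insert x W) a A)) +
     (\<Sum>A\<in>insert x ` Pow W. F (signed_sum (insert x W) a A))"
    unfolding Pow_insert using W by (intro sum.union_disjoint) auto
  also have "(\<Sum>A\<in>insert x ` Pow W. F (signed_sum (insert x W) a A)) =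
      (\<Sum>A\<in>Pow W. F (signed_sum W a A + a x))"
    using inj by (simp add: sum.reindex inn)
  also have "(\<Sum>A\<in>Pow W. F (signed_sum (insert x W) a A)) =
      (\<Sum>A\<in>Pow W. F (signed_sum W a A - a x))"
    by (intro sum.cong) (simp_all add: out)
  finally show ?thesis by (simp add: sum.distrib)
qed

lemma signed_sum_second_moment:
  assumes "finite W"
  shows "(\<Sum>A\<in>Pow W. (signed_sum W a A)\<^sup>2) = 2 ^ card W * (\<Sum>t\<in>W. (a t)\<^sup>2)"
  using assms
proof (induction W)
  case empty
  then show ?case by (simp add: signed_sum_def)
next
  case (insert x W)
  have "(\<Sum>A\<in>Pow (insert x W). (signed_sum (insert x W) a A)\<^sup>2) =
      (\<Sum>A\<in>Pow W. 2 * (signed_sum W a A)\<^sup>2 + 2 * (a x)\<^sup>2)"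
    unfolding sum_Pow_insert_signed_sum[OF insert.hyps, of "\<lambda>y. y\<^sup>2"]
    by (intro sum.cong) (auto simp: power2_eq_square algebra_simps)
  also have "\<dots> = 2 * (\<Sum>A\<in>Pow W. (signed_sum W a A)\<^sup>2) + 2 ^ card W * (2 * (a x)\<^sup>2)"
    using insert.hyps by (simp add: sum.distrib sum_distrib_left[symmetric] card_Pow)
  finally show ?case
    using insert by (simp add: algebra_simps)
qed

lemma signed_sum_fourth_moment:
  assumes "finite W"
  shows "(\<Sum>A\<in>Pow W. (signed_sum W a A) ^ 4) \<le> 3 * 2 ^ card W * (\<Sum>t\<in>W. (a t)\<^sup>2)\<^sup>2"
  using assms
proof (induction W)
  case empty
  then show ?case by (simp add: signed_sum_def)
next
  case (insert x W)
  define S where "S = (\<Sum>t\<in>W. (a t)\<^sup>2)"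
  define P where "P = (2::real) ^ card W"
  have P: "0 \<le> P" by (simp add: P_def)
  have "(\<Sum>A\<in>Pow (insert x W). (signed_sum (insert x W) a A) ^ 4) =
      (\<Sum>A\<in>Pow W. 2 * (signed_sum W a A) ^ 4 + 12 * (a x)\<^sup>2 * (signed_sum W a A)\<^sup>2 + 2 * (a x) ^ 4)"
    unfolding sum_Pow_insert_signed_sum[OF insert.hyps, of "\<lambda>y. y ^ 4"]
    by (intro sum.cong) (auto simp: power4_eq_xxxx power2_eq_square algebra_simps)
  also have "\<dots> = 2 * (\<Sum>A\<in>Pow W. (signed_sum W a A) ^ 4) +
      12 * (a x)\<^sup>2 * (\<Sum>A\<in>Pow W. (signed_sum W a A)\<^sup>2) + P * (2 * (a x) ^ 4)"
    using insert.hyps by (simp add: sum.distrib sum_distrib_left[symmetric] card_Pow P_def)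
  also have "\<dots> \<le> 2 * (3 * P * S\<^sup>2) + 12 * (a x)\<^sup>2 * (P * S) + P * (2 * (a x) ^ 4)"
    using insert.IH unfolding signed_sum_second_moment[OF insert.hyps(1)] S_def P_def by simp
  also have "\<dots> = 3 * (2 * P) * (S + (a x)\<^sup>2)\<^sup>2 - 4 * P * (a x) ^ 4"
    by (simp add: power4_eq_xxxx power2_eq_square algebra_simps)
  also have "\<dots> \<le> 3 * (2 * P) * (S + (a x)\<^sup>2)\<^sup>2"
    using P by simp
  also have "\<dots> = 3 * 2 ^ card (insert x W) * (\<Sum>t\<in>insert x W. (a t)\<^sup>2)\<^sup>2"
    using insert.hyps by (simp add: S_def P_def add.commute)
  finally show ?case .
qed

lemma powr_le_one_plus_square:
  fixes y p :: real
  assumes "0 \<le> y" "0 < p" "p \<le> 2"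
  shows "y powr p \<le> 1 + y\<^sup>2"
proof (cases "y \<le> 1")
  case True
  then have "y powr p \<le> 1" using assms powr_mono2[of p y 1] by simp
  then show ?thesis using zero_le_power2[of y] by linarith
next
  case False
  then have "y powr p \<le> y powr 2" using assms by (intro powr_mono) auto
  then show ?thesis using False by simp
qed

text \<open>This inequality interpolates the second moment between the \<open>p\<close>-th and the fourth. The constant
  \<open>6\<close> is chosen so that the fourth moment, at most three times the squared variance, absorbs just
  half of the second moment.\<close>

lemma square_le_powr_plus_fourth:
  fixes y p :: real
  assumes "0 \<le> y" "0 < p" "p \<le> 2"
  shows "y\<^sup>2 \<le> 6 * y powr p + y ^ 4 / 6"
proof -
  have y4: "y ^ 4 = y\<^sup>2 * y\<^sup>2" by (simp add: power4_eq_xxxx power2_eq_square)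
  consider "y = 0" | "0 < y" "y \<le> 1" | "1 < y" "y\<^sup>2 \<le> 6" | "6 < y\<^sup>2" using assms by fastforce
  then show ?thesis
  proof cases
    case 2
    then have "y powr 2 \<le> y powr p" using assms by (intro powr_mono') auto
    then have "y\<^sup>2 \<le> y powr p" using 2 by simp
    moreover have "y powr p \<le> 6 * y powr p" by simp
    moreover have "0 \<le> y ^ 4 / 6" by simp
    ultimately show ?thesis by linarith
  next
    case 3
    then have "1 \<le> y powr p" using assms by (intro ge_one_powr_ge_zero) auto
    moreover have "0 \<le> y ^ 4 / 6" by simp
    ultimately show ?thesis using 3 by linarith
  next
    case 4
    then have "6 * y\<^sup>2 \<le> y ^ 4" unfolding y4 by (intro mult_right_mono) auto
    then show ?thesis using powr_ge_zero[of y p] by linarith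
  qed simp
qed

text \<open>After division by \<open>\<sigma>\<close> the second moment is \<open>1\<close> and the fourth at most \<open>3\<close>, so that averaging
  the two preceding pointwise inequalities gives both bounds.\<close>

lemma khintchine:
  fixes a :: "'a \<Rightarrow> real"
  assumes W: "finite W" and p: "0 < p" "p \<le> 2"
  defines "\<sigma> \<equiv> L2_set a W"
  shows "(\<Sum>A\<in>Pow W. \<bar>signed_sum W a A\<bar> powr p) \<le> 2 * 2 ^ card W * \<sigma> powr p" (is "?M \<le> _")
    and "2 ^ card W * \<sigma> powr p \<le> 12 * (\<Sum>A\<in>Pow W. \<bar>signed_sum W a A\<bar> powr p)"
proof -
  have "?M \<le> 2 * 2 ^ card W * \<sigma> powr p \<and> 2 ^ card W * \<sigma> powr p \<le> 12 * ?M"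
  proof (cases "\<sigma> = 0")
    case True
    then have "signed_sum W a A = 0" for A
      using W by (simp add: \<sigma>_def L2_set_eq_0_iff signed_sum_def)
    then show ?thesis using True by simp
  next
    case False
    then have s: "0 < \<sigma>" unfolding \<sigma>_def by (simp add: less_le L2_set_nonneg)
    have s2: "(\<Sum>t\<in>W. (a t)\<^sup>2) = \<sigma>\<^sup>2"
      unfolding \<sigma>_def L2_set_def by (simp add: sum_nonneg)
    define y where "y A = \<bar>signed_sum W a A\<bar> / \<sigma>" for A
    have y0: "0 \<le> y A" for A using s by (simp add: y_def)
    have P: "(\<Sum>A\<in>Pow W. 1) = (2::real) ^ card W" using W by (simp add: card_Pow)
    have m2: "(\<Sum>A\<in>Pow W. (y A)\<^sup>2) = 2 ^ card W"
      using signed_sum_second_moment[OF W, of a] s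
      by (simp add: y_def power_divide sum_divide_distrib[symmetric] s2)
    have m4: "(\<Sum>A\<in>Pow W. (y A) ^ 4) \<le> 3 * 2 ^ card W"
    proof -
      have "(\<Sum>A\<in>Pow W. (signed_sum W a A) ^ 4) \<le> (3 * 2 ^ card W) * \<sigma> ^ 4"
        using signed_sum_fourth_moment[OF W, of a] unfolding s2 by simp
      then have "(\<Sum>A\<in>Pow W. (signed_sum W a A) ^ 4) / \<sigma> ^ 4 \<le> 3 * 2 ^ card W"
        using s by (simp add: pos_divide_le_eq)
      then show ?thesis
        by (simp add: y_def power_divide sum_divide_distrib[symmetric])
    qed
    have mp: "?M = \<sigma> powr p * (\<Sum>A\<in>Pow W. y A powr p)"
      using s by (simp add: y_def powr_divide sum_distrib_left)
    have "(\<Sum>A\<in>Pow W. y A powr p) \<le> (\<Sum>A\<in>Pow W. 1 + (y A)\<^sup>2)"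
      using p y0 by (intro sum_mono powr_le_one_plus_square)
    also have "\<dots> = 2 * 2 ^ card W"
      unfolding sum.distrib m2 P by simp
    finally have up: "(\<Sum>A\<in>Pow W. y A powr p) \<le> 2 * 2 ^ card W" .
    have "(\<Sum>A\<in>Pow W. (y A)\<^sup>2) \<le> (\<Sum>A\<in>Pow W. 6 * y A powr p + (y A) ^ 4 / 6)"
      using p y0 by (intro sum_mono square_le_powr_plus_fourth)
    also have "\<dots> = 6 * (\<Sum>A\<in>Pow W. y A powr p) + (\<Sum>A\<in>Pow W. (y A) ^ 4) / 6"
      by (simp add: sum.distrib sum_distrib_left sum_divide_distrib)
    finally have lo: "2 ^ card W \<le> 12 * (\<Sum>A\<in>Pow W. y A powr p)"
      using m4 unfolding m2 by linarith
    show ?thesis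
      unfolding mp using mult_left_mono[OF up powr_ge_zero[of \<sigma> p]]
        mult_left_mono[OF lo powr_ge_zero[of \<sigma> p]]
      by (simp add: mult_ac)
  qed
  then show "?M \<le> 2 * 2 ^ card W * \<sigma> powr p" "2 ^ card W * \<sigma> powr p \<le> 12 * ?M" by auto
qed

text \<open>The vector \<open>a\<close> is sent to the random variable \<open>signed_sum W a\<close> on the uniform probability space
  \<open>Pow W\<close>, whose points are listed as the first \<open>K\<close> coordinates and weighted by \<open>1 / K\<close>.\<close>

lemma finite_Hilbert_into_lp:
  fixes W :: "'a set"
  assumes W: "finite W" and p: "1 \<le> p" "p \<le> 2"
  obtains g :: "('a \<Rightarrow> real) \<Rightarrow> nat \<Rightarrow> real" where "\<And>a. g a \<in> lp_space p"
    "\<And>a b. L2_set (\<lambda>t. a t - b t) W / 12 \<le> lp_dist p (g a) (g b)"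
    "\<And>a b. lp_dist p (g a) (g b) \<le> 2 * L2_set (\<lambda>t. a t - b t) W"
proof -
  define K :: nat where "K = 2 ^ card W"
  have "card {..<K} = card (Pow W)" using W by (simp add: K_def card_Pow)
  then obtain e where e: "bij_betw e {..<K} (Pow W)"
    using W finite_same_card_bij[of "{..<K}" "Pow W"] by auto
  define g where "g a n = (if n < K then (1 / K) powr (1 / p) * signed_sum W a (e n) else 0)"
    for a :: "'a \<Rightarrow> real" and n
  have fin: "g a \<in> lp_space p" for a
    unfolding lp_space_def
    by (auto intro!: summable_finite[of "{..<K}"] simp: g_def split: if_splits)
  have K0: "0 < real K" by (simp add: K_def)
  have pow: "real K * lp_pow p (\<lambda>n. g a n - g b n) =
      (\<Sum>A\<in>Pow W. \<bar>signed_sum W (\<lambda>t. a t - b t) A\<bar> powr p)" for a b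
  proof -
    have "lp_pow p (\<lambda>n. g a n - g b n) = (\<Sum>n<K. \<bar>g a n - g b n\<bar> powr p)"
      unfolding lp_pow_def by (rule suminf_finite) (auto simp: g_def)
    also have "\<dots> = (\<Sum>n<K. 1 / K * \<bar>signed_sum W (\<lambda>t. a t - b t) (e n)\<bar> powr p)"
    proof (intro sum.cong refl)
      fix n assume "n \<in> {..<K}"
      then have "g a n - g b n = (1 / K) powr (1 / p) * signed_sum W (\<lambda>t. a t - b t) (e n)"
        by (simp add: g_def signed_sum_def right_diff_distrib sum_subtractf)
      then show "\<bar>g a n - g b n\<bar> powr p = 1 / K * \<bar>signed_sum W (\<lambda>t. a t - b t) (e n)\<bar> powr p"
        using p by (simp add: abs_mult powr_mult powr_powr)
    qed
    also have "\<dots> = 1 / K * (\<Sum>A\<in>Pow W. \<bar>signed_sum W (\<lambda>t. a t - b t) A\<bar> powr p)"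
      unfolding sum_distrib_left[symmetric]
      using sum.reindex_bij_betw[OF e, of "\<lambda>A. \<bar>signed_sum W (\<lambda>t. a t - b t) A\<bar> powr p"]
      by simp
    finally show ?thesis using K0 by simp
  qed
  have "L2_set (\<lambda>t. a t - b t) W / 12 \<le> lp_dist p (g a) (g b) \<and>
      lp_dist p (g a) (g b) \<le> 2 * L2_set (\<lambda>t. a t - b t) W" for a b
  proof -
    define \<sigma> where "\<sigma> = L2_set (\<lambda>t. a t - b t) W"
    have \<sigma>: "0 \<le> \<sigma>" by (simp add: \<sigma>_def L2_set_nonneg)
    have KK: "2 ^ card W = real K" by (simp add: K_def)
    have "real K * lp_pow p (\<lambda>n. g a n - g b n) \<le> real K * (2 * \<sigma> powr p)"
      "real K * \<sigma> powr p \<le> real K * (12 * lp_pow p (\<lambda>n. g a n - g b n))"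
      using khintchine[OF W, of p "\<lambda>t. a t - b t"] p
      unfolding pow[symmetric] KK \<sigma>_def[symmetric] by (simp_all add: mult_ac)
    then have le: "lp_pow p (\<lambda>n. g a n - g b n) \<le> 2 * \<sigma> powr p"
      "\<sigma> powr p / 12 \<le> lp_pow p (\<lambda>n. g a n - g b n)"
      using K0 by simp_all
    have pw: "c \<le> c powr p" if "1 \<le> c" for c :: real
      using powr_mono[of 1 p c] p that by simp
    have "2 * \<sigma> powr p \<le> 2 powr p * \<sigma> powr p"
      by (intro mult_right_mono pw) auto
    then have 1: "lp_pow p (\<lambda>n. g a n - g b n) \<le> (2 * \<sigma>) powr p"
      using le \<sigma> by (simp add: powr_mult)
    have "\<sigma> powr p / 12 powr p \<le> \<sigma> powr p / 12"
      by (intro divide_left_mono pw) auto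
    then have "\<sigma> powr p / 12 powr p \<le> lp_pow p (\<lambda>n. g a n - g b n)"
      using le(2) by (rule order_trans)
    then have 2: "(\<sigma> / 12) powr p \<le> lp_pow p (\<lambda>n. g a n - g b n)"
      using \<sigma> by (simp add: powr_divide)
    have d: "(\<lambda>n. g a n - g b n) \<in> lp_space p"
      using p fin by (intro lp_diff) auto
    show ?thesis
      unfolding \<sigma>_def[symmetric] lp_dist_def
      using lp_norm_le_iff[OF _ d, of "2 * \<sigma>"] lp_norm_ge_iff[OF _ d, of "\<sigma> / 12"] 1 2 p \<sigma> by simp
  qed
  then show thesis using that[of g] fin by blast
qed

section \<open>Embedding trees in Hilbert space\<close>

text \<open>The coordinate of the vertex \<open>s\<close> at its ancestor \<open>t\<close>. The square root of the distance grows
  fast enough for the squares along a path to add up to the order of the square of its length, but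
  so slowly that the squared increments are summed by the harmonic series.\<close>

definition bourgain_weight :: "'a list \<Rightarrow> 'a list \<Rightarrow> real" where
  "bourgain_weight s t = (if prefix t s then sqrt (1 + real (length s) - real (length t)) else 0)"

lemma sqrt_Suc_diff_square:
  fixes x :: real
  assumes "1 \<le> x"
  shows "(sqrt x - sqrt (x + 1))\<^sup>2 \<le> 1 / x"
proof -
  have "(sqrt (x + 1) - sqrt x) * (sqrt (x + 1) + sqrt x) = 1"
    using assms by (simp add: algebra_simps)
  moreover have "0 < sqrt (x + 1) + sqrt x" using assms by (simp add: add_pos_pos)
  ultimately have "sqrt (x + 1) - sqrt x = 1 / (sqrt (x + 1) + sqrt x)"
    by (simp add: eq_divide_eq)
  then have "\<bar>sqrt x - sqrt (x + 1)\<bar> = 1 / (sqrt (x + 1) + sqrt x)"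
    using \<open>0 < sqrt (x + 1) + sqrt x\<close> by (simp add: abs_minus_commute)
  also have "\<dots> \<le> 1 / sqrt x"
    using assms \<open>0 < sqrt (x + 1) + sqrt x\<close> by (intro divide_left_mono mult_pos_pos) auto
  finally have "\<bar>sqrt x - sqrt (x + 1)\<bar>\<^sup>2 \<le> (1 / sqrt x)\<^sup>2"
    by (intro power_mono) auto
  then show ?thesis using assms by (simp add: power_divide power2_commute)
qed

text \<open>Passing to a child lengthens the distance to every ancestor by one. The new coordinate
  contributes \<open>1\<close>, and an ancestor at distance \<open>i\<close> contributes at most \<open>1 / (i + 1)\<close>.\<close>

lemma bourgain_weight_edge:
  fixes s :: "'a list"
  assumes W: "finite W"
  shows "(\<Sum>t\<in>W. (bourgain_weight s t - bourgain_weight (s @ [n]) t)\<^sup>2) \<le> harm (Suc (length s)) + 1"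
proof -
  let ?s' = "s @ [n]"
  define D where "D t = (bourgain_weight s t - bourgain_weight ?s' t)\<^sup>2" for t
  define P where "P = (\<lambda>j. take j s) ` {..length s}"
  have P: "t \<in> P \<longleftrightarrow> prefix t s" for t
  proof
    assume "prefix t s"
    then show "t \<in> P" unfolding P_def
      by (intro image_eqI[of _ _ "length t"]) (auto simp: prefix_def)
  qed (auto simp: P_def take_is_prefix)
  have zero: "D t = 0" if "t \<notin> insert ?s' P" for t
    using that by (auto simp: P D_def bourgain_weight_def)
  have "(\<Sum>t\<in>W. D t) = (\<Sum>t\<in>W \<inter> insert ?s' P. D t)"
    using W zero by (intro sum.mono_neutral_right) auto
  also have "\<dots> \<le> (\<Sum>t\<in>insert ?s' P. D t)"
    by (intro sum_mono2) (auto simp: P_def D_def)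
  also have "\<dots> \<le> D ?s' + (\<Sum>t\<in>P. D t)"
    by (subst sum.insert_if) (auto simp: P_def D_def)
  also have "D ?s' = 1"
    by (simp add: D_def bourgain_weight_def)
  also have "(\<Sum>t\<in>P. D t) = (\<Sum>j\<le>length s. D (take j s))"
    unfolding P_def
    by (subst sum.reindex) (auto simp: inj_on_def dest: arg_cong[of _ _ length])
  also have "\<dots> \<le> (\<Sum>j\<le>length s. 1 / real (Suc (length s - j)))"
  proof (intro sum_mono)
    fix j assume "j \<in> {..length s}"
    then have j: "j \<le> length s" by simp
    then have "prefix (take j s) s" "prefix (take j s) ?s'"
      by (auto simp: take_is_prefix)
    then have "D (take j s) = (sqrt (real (Suc (length s - j))) - sqrt (real (Suc (length s - j)) + 1))\<^sup>2"
      using j by (simp add: D_def bourgain_weight_def of_nat_diff algebra_simps)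
    also have "\<dots> \<le> 1 / real (Suc (length s - j))"
      by (intro sqrt_Suc_diff_square) simp
    finally show "D (take j s) \<le> 1 / real (Suc (length s - j))" .
  qed
  also have "\<dots> = (\<Sum>j\<le>length s. 1 / real (Suc j))"
    by (rule sum.reindex_bij_witness[of _ "\<lambda>j. length s - j" "\<lambda>j. length s - j"]) auto
  also have "\<dots> = harm (Suc (length s))"
    by (simp only: harm_altdef lessThan_Suc_atMost inverse_eq_divide)
  finally show ?thesis by (simp add: D_def add.commute)
qed

lemma bourgain_weight_walk:
  assumes W: "finite W" and k: "(s, t) \<in> tree_edges h ^^ k"
  shows "L2_set (\<lambda>v. bourgain_weight s v - bourgain_weight t v) W \<le> sqrt (harm h + 1) * k"
  using k
proof (induction k arbitrary: t)
  case 0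
  then show ?case by (simp add: L2_set_def)
next
  case (Suc k)
  then obtain u where u: "(s, u) \<in> tree_edges h ^^ k" "(u, t) \<in> tree_edges h" by auto
  have edge: "L2_set (\<lambda>v. bourgain_weight x v - bourgain_weight (x @ [n]) v) W \<le> sqrt (harm h + 1)"
    if "x @ [n] \<in> tree_vertices h" for x n
  proof -
    have "harm (Suc (length x)) \<le> (harm h :: real)"
      using that by (intro harm_mono) (auto simp: tree_vertices_def)
    then show ?thesis
      unfolding L2_set_def using bourgain_weight_edge[OF W, of x n] by simp
  qed
  have "L2_set (\<lambda>v. bourgain_weight u v - bourgain_weight t v) W \<le> sqrt (harm h + 1)"
  proof -
    obtain n where "t = u @ [n] \<or> u = t @ [n]" "u \<in> tree_vertices h" "t \<in> tree_vertices h"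
      using u(2) by (auto simp: tree_edges_def)
    then show ?thesis using edge[of u n] edge[of t n]
      by (auto simp: L2_set_def power2_commute)
  qed
  moreover have "L2_set (\<lambda>v. bourgain_weight s v - bourgain_weight t v) W \<le>
      L2_set (\<lambda>v. bourgain_weight s v - bourgain_weight u v) W +
      L2_set (\<lambda>v. bourgain_weight u v - bourgain_weight t v) W"
    using L2_set_triangle_ineq[of "\<lambda>v. bourgain_weight s v - bourgain_weight u v"
        "\<lambda>v. bourgain_weight u v - bourgain_weight t v" W] by simp
  ultimately show ?case
    using Suc.IH[OF u(1)] by (simp add: algebra_simps)
qed

lemma sum_arith_ge:
  "(real a)\<^sup>2 / 2 \<le> (\<Sum>i\<in>{1..a}. 1 + real a - real i)"
proof (induction a)
  case (Suc a)
  have "(\<Sum>i\<in>{1..Suc a}. 1 + real (Suc a) - real i) = (\<Sum>i\<in>{1..a}. (1 + real a - real i) + 1) + 1"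
    by (simp add: algebra_simps)
  also have "\<dots> = (\<Sum>i\<in>{1..a}. 1 + real a - real i) + real a + 1"
    unfolding sum.distrib by simp
  finally show ?case using Suc.IH by (simp add: power2_eq_square algebra_simps)
qed simp

lemma branch_not_prefix:
  assumes "s' = [] \<or> t' = [] \<or> hd s' \<noteq> hd t'" "i \<in> {1..length s'}"
  shows "\<not> prefix (u @ take i s') (u @ t')"
proof
  assume "prefix (u @ take i s') (u @ t')"
  then have "prefix (take i s') t'" by simp
  then obtain r where "t' = take i s' @ r" by (auto simp: prefix_def)
  then show False using assms by (cases s'; cases i) auto
qed

text \<open>Past the branching point \<open>u\<close>, the ancestors of \<open>s\<close> are not ancestors of \<open>t\<close>; on them the squared
  coordinates of \<open>s\<close> are \<open>1, 2, \<dots>\<close>, counted upwards from \<open>s\<close>.\<close>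

lemma bourgain_weight_branch:
  assumes s: "s = u @ s'" and t: "t = u @ t'" and div: "s' = [] \<or> t' = [] \<or> hd s' \<noteq> hd t'"
  shows "(real (length s'))\<^sup>2 / 2 \<le>
    (\<Sum>v\<in>(\<lambda>i. u @ take i s') ` {1..length s'}. (bourgain_weight s v - bourgain_weight t v)\<^sup>2)"
proof -
  have inj: "inj_on (\<lambda>i. u @ take i s') {1..length s'}"
    by (auto simp: inj_on_def dest: arg_cong[of _ _ length])
  have "(bourgain_weight s (u @ take i s') - bourgain_weight t (u @ take i s'))\<^sup>2 =
      1 + real (length s') - real i" if i: "i \<in> {1..length s'}" for i
  proof -
    have "prefix (u @ take i s') s" using s by (simp add: take_is_prefix)
    moreover have "\<not> prefix (u @ take i s') t"
      unfolding t using branch_not_prefix[OF div i] .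
    ultimately show ?thesis using i by (simp add: bourgain_weight_def s)
  qed
  then have "(\<Sum>v\<in>(\<lambda>i. u @ take i s') ` {1..length s'}. (bourgain_weight s v - bourgain_weight t v)\<^sup>2)
      = (\<Sum>i\<in>{1..length s'}. 1 + real (length s') - real i)"
    unfolding sum.reindex[OF inj] by (intro sum.cong) auto
  then show ?thesis using sum_arith_ge by simp
qed

text \<open>The two branches below the branching point occupy disjoint sets of coordinates and contribute at least
  \<open>a\<^sup>2 / 2\<close> and \<open>b\<^sup>2 / 2\<close>, where \<open>a + b\<close> is the distance; and \<open>(a + b)\<^sup>2 \<le> 2 * (a\<^sup>2 + b\<^sup>2)\<close>.\<close>

lemma bourgain_weight_lower:
  assumes W: "finite W" and sW: "\<And>v. prefix v s \<Longrightarrow> v \<in> W" and tW: "\<And>v. prefix v t \<Longrightarrow> v \<in> W"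
  shows "real (tree_dist s t) / 2 \<le> L2_set (\<lambda>v. bourgain_weight s v - bourgain_weight t v) W"
proof -
  obtain u s' t' where d: "s = u @ s'" "t = u @ t'" "tree_dist s t = length s' + length t'"
    "s' = [] \<or> t' = [] \<or> hd s' \<noteq> hd t'"
    by (rule tree_dist_split)
  then have d': "t' = [] \<or> s' = [] \<or> hd t' \<noteq> hd s'" by auto
  define D where "D v = (bourgain_weight s v - bourgain_weight t v)\<^sup>2" for v
  define S where "S = (\<lambda>i. u @ take i s') ` {1..length s'}"
  define T where "T = (\<lambda>i. u @ take i t') ` {1..length t'}"
  have "prefix v s \<and> \<not> prefix v t" if "v \<in> S" for v
    using that branch_not_prefix[OF d(4), of _ u] by (auto simp: S_def d(1,2) take_is_prefix)
  moreover have Tt: "prefix v t" if "v \<in> T" for v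
    using that by (auto simp: T_def d(2) take_is_prefix)
  ultimately have disj: "S \<inter> T = {}" and sub: "S \<union> T \<subseteq> W"
    using sW tW by blast+
  have "(real (length s'))\<^sup>2 / 2 \<le> (\<Sum>v\<in>S. D v)"
    unfolding S_def D_def by (rule bourgain_weight_branch[OF d(1,2,4)])
  moreover have "(real (length t'))\<^sup>2 / 2 \<le> (\<Sum>v\<in>T. D v)"
    unfolding T_def D_def using bourgain_weight_branch[OF d(2,1) d'] by (simp add: power2_commute)
  moreover have "(\<Sum>v\<in>S. D v) + (\<Sum>v\<in>T. D v) = (\<Sum>v\<in>S \<union> T. D v)"
    using disj by (subst sum.union_disjoint) (auto simp: S_def T_def)
  moreover have "(\<Sum>v\<in>S \<union> T. D v) \<le> (\<Sum>v\<in>W. D v)"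
    using W sub by (intro sum_mono2) (auto simp: D_def)
  moreover have "(real (length s') + real (length t'))\<^sup>2 / 4 \<le>
      (real (length s'))\<^sup>2 / 2 + (real (length t'))\<^sup>2 / 2"
    using zero_le_power2[of "real (length s') - real (length t')"]
    by (simp add: power2_eq_square algebra_simps)
  ultimately have "(real (tree_dist s t) / 2)\<^sup>2 \<le> (\<Sum>v\<in>W. D v)"
    by (simp add: d(3) power_divide)
  then show ?thesis
    unfolding L2_set_def D_def[symmetric] by (rule real_le_rsqrt)
qed

text \<open>A finite set of vertices has only finitely many ancestors, hence its image in Hilbert space lies
  in a finite-dimensional coordinate subspace, which embeds in \<open>\<ell>\<^sub>p\<close> with bounded distortion.\<close>

lemma tree_finitely_representable:
  assumes p: "1 \<le> p" "p \<le> 2"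
  shows "finitely_representable (48 * sqrt (harm h + 1)) (tree_metric h) (lp_metric p)"
  unfolding finitely_representable_def
proof (intro allI impI, elim conjE)
  fix F assume F: "finite F" "F \<subseteq> mspace (tree_metric h)"
  let ?C = "sqrt (harm h + 1)"
  define W where "W = (\<Union>s\<in>F. set (prefixes s))"
  have W: "finite W" using F by (simp add: W_def)
  have inW: "v \<in> W" if "prefix v s" "s \<in> F" for v s
    using that by (auto simp: W_def)
  obtain g :: "(nat list \<Rightarrow> real) \<Rightarrow> nat \<Rightarrow> real" where g: "\<And>a. g a \<in> lp_space p"
    "\<And>a b. L2_set (\<lambda>t. a t - b t) W / 12 \<le> lp_dist p (g a) (g b)"
    "\<And>a b. lp_dist p (g a) (g b) \<le> 2 * L2_set (\<lambda>t. a t - b t) W"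
    using finite_Hilbert_into_lp[OF W p] by blast
  have ms: "mspace (submetric (tree_metric h) F) = F"
    using F by (auto simp: mspace_submetric)
  \<comment> \<open>The constant \<open>24\<close> is the product of the loss \<open>12\<close> in \<open>\<ell>\<^sub>p\<close> and the loss \<open>2\<close> in Hilbert space.\<close>
  have "c_dist (lp_metric p) (submetric (tree_metric h) F) \<le> ereal (2 * ?C / (1 / 24))"
  proof (rule c_dist_le[where f = "\<lambda>s. g (bourgain_weight s)"])
    fix s t assume "s \<in> mspace (submetric (tree_metric h) F)" "t \<in> mspace (submetric (tree_metric h) F)"
    then have F': "s \<in> F" "t \<in> F" unfolding ms by auto
    with F have V: "s \<in> tree_vertices h" "t \<in> tree_vertices h" by auto
    have d: "mdist (submetric (tree_metric h) F) s t = real (tree_dist s t)"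
      by (simp add: path_dist_tree[OF V])
    have "real (tree_dist s t) / 2 \<le> L2_set (\<lambda>v. bourgain_weight s v - bourgain_weight t v) W"
      using F' inW by (intro bourgain_weight_lower W) auto
    then show "1 / 24 * mdist (submetric (tree_metric h) F) s t \<le>
        mdist (lp_metric p) (g (bourgain_weight s)) (g (bourgain_weight t))"
      unfolding d using g(2)[of "bourgain_weight s" "bourgain_weight t"] p by simp
    show "mdist (lp_metric p) (g (bourgain_weight s)) (g (bourgain_weight t)) \<le>
        2 * ?C * mdist (submetric (tree_metric h) F) s t"
      unfolding d using g(3)[of "bourgain_weight s" "bourgain_weight t"] p
        bourgain_weight_walk[OF W tree_walk_shortest[OF V]] by simp
  qed (use p g harm_nonneg[of h, where 'a = real] in auto)
  then show "c_dist (lp_metric p) (submetric (tree_metric h) F) \<le> ereal (48 * ?C)"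
    by simp
qed

text \<open>The harmonic number exceeds the logarithm by at most \<open>1\<close>, and \<open>ln 2 \<le> 1\<close>.\<close>

lemma harm_power2_le: "harm (2 ^ m) \<le> (real m + 1 :: real)"
proof -
  have "harm (2 ^ m) - ln (real (2 ^ m)) \<le> harm 1 - ln (real 1)"
    by (rule euler_mascheroni_sequence_decreasing) auto
  moreover have "ln (real (2 ^ m)) = real m * ln 2" by (simp add: ln_realpow)
  moreover have "real m * ln 2 \<le> real m * 1"
    using ln_le_minus_one[of "2::real"] by (intro mult_left_mono) auto
  ultimately show ?thesis by (simp add: harm_def)
qed

section \<open>Finite representability against embeddability\<close>

text \<open>Multiplying the embedding by the Lipschitz constant \<open>A\<close> of its inverse makes it noncontracting;
  its Lipschitz constant becomes \<open>A * B\<close>, which is essentially the distortion.\<close>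

lemma tree_distortion_lower_bound:
  assumes p: "1 < p" and K: "c_dist (lp_metric p) (tree_metric (2 ^ m)) < ereal K"
  shows "real m * fork_gain p \<le> K powr p"
proof -
  obtain f A B where f: "f \<in> mspace (tree_metric (2 ^ m)) \<rightarrow> mspace (lp_metric p)"
    and AB: "0 \<le> A" "0 \<le> B" "A * B < K"
    and up: "\<And>x y. x \<in> mspace (tree_metric (2 ^ m)) \<Longrightarrow> y \<in> mspace (tree_metric (2 ^ m)) \<Longrightarrow>
      mdist (lp_metric p) (f x) (f y) \<le> B * mdist (tree_metric (2 ^ m)) x y"
    and lo: "\<And>x y. x \<in> mspace (tree_metric (2 ^ m)) \<Longrightarrow> y \<in> mspace (tree_metric (2 ^ m)) \<Longrightarrow>
      mdist (tree_metric (2 ^ m)) x y \<le> A * mdist (lp_metric p) (f x) (f y)"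
    by (rule c_dist_less_imp_embedding[OF K]) blast
  define V where "V = tree_vertices (2 ^ m)"
  have f_in: "f s \<in> lp_space p" if "s \<in> V" for s
    using f that p by (auto simp: V_def)
  have diff_in: "(\<lambda>i. f s i - f t i) \<in> lp_space p" if "s \<in> V" "t \<in> V" for s t
    using p f_in that by (intro lp_diff) auto
  define g where "g s = (\<lambda>i. A * f s i)" for s
  have pow: "lp_pow p (\<lambda>i. g s i - g t i) = (A * lp_dist p (f s) (f t)) powr p"
    if "s \<in> V" "t \<in> V" for s t
  proof -
    have "lp_pow p (\<lambda>i. g s i - g t i) = lp_pow p (\<lambda>i. A * (f s i - f t i))"
      by (simp add: g_def right_diff_distrib)
    also have "\<dots> = A powr p * lp_dist p (f s) (f t) powr p"
      using lp_scale(2)[OF diff_in[OF that], of A] lp_norm_powr[OF _ diff_in[OF that]] p AB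
      by (simp add: lp_dist_def)
    finally show ?thesis using AB by (simp add: powr_mult lp_dist_def)
  qed
  have dist0: "0 \<le> lp_dist p x y" for x y by (simp add: lp_dist_def)
  have "tree_embedding p (2 ^ m) (K powr p) g"
    unfolding tree_embedding_def
  proof (intro conjI ballI allI impI)
    fix s assume "s \<in> tree_vertices (2 ^ m)"
    then show "g s \<in> lp_space p" unfolding g_def by (intro lp_scale f_in) (simp add: V_def)
  next
    fix s k assume sk: "s @ [k] \<in> tree_vertices (2 ^ m)"
    then have s: "s \<in> tree_vertices (2 ^ m)" by (auto simp: tree_vertices_def)
    have "tree_dist s (s @ [k]) = 1" using tree_dist_append[of s "[]" "[k]"] by simp
    then have "lp_dist p (f s) (f (s @ [k])) \<le> B"
      using up[of s "s @ [k]"] s sk p by (simp add: path_dist_tree)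
    then have "A * lp_dist p (f s) (f (s @ [k])) \<le> A * B" using AB by (intro mult_left_mono)
    then show "lp_pow p (\<lambda>i. g s i - g (s @ [k]) i) \<le> K powr p"
      using pow[of s "s @ [k]"] s sk AB p dist0 by (auto simp: V_def intro!: powr_mono2)
  next
    fix s t assume st: "s \<in> tree_vertices (2 ^ m)" "t \<in> tree_vertices (2 ^ m)"
    then have "real (tree_dist s t) \<le> A * lp_dist p (f s) (f t)"
      using lo[of s t] p by (simp add: path_dist_tree)
    then show "real (tree_dist s t) powr p \<le> lp_pow p (\<lambda>i. g s i - g t i)"
      using pow[of s t] st p by (auto simp: V_def intro!: powr_mono2)
  qed
  then show ?thesis by (rule tree_embedding_lower_bound[OF p])
qed

text \<open>The left-hand side grows like \<open>m powr (p / 2)\<close>. This is where \<open>p < 2\<close> separates the exponents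
  \<open>1/p\<close> and \<open>1/2\<close> of the logarithm.\<close>

lemma linear_beats_powr:
  fixes p c M :: real
  assumes "p < 2" "0 < c" "0 < M"
  obtains m :: nat where "(M * sqrt (real m + 2)) powr p < c * real m"
proof -
  have "filterlim (\<lambda>m::nat. c * real m - (M * sqrt (real m + 2)) powr p) at_top at_top"
    using assms by real_asymp
  then have "eventually (\<lambda>m. 0 < c * real m - (M * sqrt (real m + 2)) powr p) at_top"
    unfolding filterlim_at_top_dense by blast
  then show thesis using that by (auto simp: eventually_sequentially)
qed

theorem proposition4p4:
  fixes p :: real
  assumes "1 < p" and "p < 2"
  shows "\<not> (\<exists>\<mu>::real. 0 < \<mu> \<and>
           (\<forall>h::nat. \<forall>l::real. 1 \<le> h \<longrightarrow> 1 \<le> l \<longrightarrow>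
              finitely_representable l (tree_metric h) (lp_metric p) \<longrightarrow>
              c_dist (lp_metric p) (tree_metric h) \<le> ereal (\<mu> * l)))"
proof
  assume "\<exists>\<mu>::real. 0 < \<mu> \<and>
           (\<forall>h::nat. \<forall>l::real. 1 \<le> h \<longrightarrow> 1 \<le> l \<longrightarrow>
              finitely_representable l (tree_metric h) (lp_metric p) \<longrightarrow>
              c_dist (lp_metric p) (tree_metric h) \<le> ereal (\<mu> * l))"
  then obtain \<mu> :: real where \<mu>: "0 < \<mu>"
    and le: "\<And>h l. 1 \<le> h \<Longrightarrow> 1 \<le> l \<Longrightarrow> finitely_representable l (tree_metric h) (lp_metric p) \<Longrightarrow>
      c_dist (lp_metric p) (tree_metric h) \<le> ereal (\<mu> * l)"
    by blast
  \<comment> \<open>The summand \<open>1\<close> makes room for a strict inequality, as the infimum in \<open>c_dist\<close> need not be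
    attained.\<close>
  define M where "M = 48 * \<mu> + 1"
  obtain m :: nat where m: "(M * sqrt (real m + 2)) powr p < fork_gain p * real m"
    using linear_beats_powr[of p "fork_gain p" M] assms fork_gain_pos[of p] \<mu> by (auto simp: M_def)
  define l where "l = 48 * sqrt (harm (2 ^ m) + 1)"
  have "1 \<le> sqrt (harm (2 ^ m) + 1)" using harm_nonneg[of "2 ^ m", where 'a = real] by simp
  then have "1 \<le> l" unfolding l_def by linarith
  moreover have "finitely_representable l (tree_metric (2 ^ m)) (lp_metric p)"
    unfolding l_def using assms by (intro tree_finitely_representable) auto
  ultimately have "c_dist (lp_metric p) (tree_metric (2 ^ m)) \<le> ereal (\<mu> * l)"
    by (intro le) auto
  also have "\<mu> * l < M * sqrt (real m + 2)"
  proof -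
    have "sqrt (harm (2 ^ m) + 1) \<le> sqrt (real m + 2)" using harm_power2_le[of m] by simp
    then have "\<mu> * l \<le> (48 * \<mu>) * sqrt (real m + 2)" using \<mu> by (simp add: l_def)
    also have "\<dots> < M * sqrt (real m + 2)"
      by (intro mult_strict_right_mono) (auto simp: M_def)
    finally show ?thesis .
  qed
  then have "ereal (\<mu> * l) < ereal (M * sqrt (real m + 2))" by simp
  finally have "real m * fork_gain p \<le> (M * sqrt (real m + 2)) powr p"
    using tree_distortion_lower_bound assms by blast
  then show False using m by (simp add: mult.commute)
qed

end
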